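(* Let $G=G_{2,f}$ be a non-torsion Šunić group acting on the binary rooted tree, with defining polynomial $f$ of degree $m\ge 2$, and let $b\in B$ be the element with $\psi(b)=(a,b)$. Then for each odd integer $q\ge 3$ the subgroup $H(q):=\langle (ab)^q,B\rangle$ is a proper subgroup of $G$ and is dense in $G$ for the profinite topology.
   Context: Let $X=\{\mathbf 0,\mathbf 1\}$ and let $T$ be the binary rooted tree with vertex set $X^*$ (finite words; $w$ is joined to $wx$ for $x\in X$). $\mathrm{Aut}\,T$ acts on the left. For $g\in\mathrm{Aut}\,T$ and a vertex $v$, $g_v\in \mathrm{Aut}\,T$ is the unique automorphism with $g(vw)=g(v)g_v(w)$ for all $w$; if $g$ fixes the first level $X$ pointwise, write $\psi(g)=(g_{\mathbf 0},g_{\mathbf 1})$. Šunić groups on the binary tree: let $f(x)=x^m+a_{m-1}x^{m-1}+\dots+a_1x+a_0\in\mathbb F_2[x]$ with $m\ge 1$, $a_0\neq 0$. Let $B\cong(\mathbb Z/2)^m$ be written multiplicatively with basis $b_0,\dots,b_{m-1}$; let $\rho\colon B\to B$ be the automorphism with $\rho(b_i)=b_{i+1}$ for $0\le i\le m-2$ and $\rho(b_{m-1})=b_0^{-a_0}b_1^{-a_1}\cdots b_{m-1}^{-a_{m-1}}$. Let $A=\langle a\rangle$ be of order 2 and $\omega\colon B\to A$ the homomorphism with $\omega(b_i)=1$ for $i\le m-2$ and $\omega(b_{m-1})=a$. Then $a$ acts on $T$ by swapping the first letter ($a(\mathbf 0w)=\mathbf 1w$, $a(\mathbf 1w)=\mathbf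 0w$), and $x\in B$ acts recursively by fixing the first level with $\psi(x)=(\omega(x),\rho(x))$. These actions are faithful, and $G_{2,f}:=\langle A\cup B\rangle\le\mathrm{Aut}\,T$. Non-torsion means containing an element of infinite order; in that case there is a unique $b\in B$ with $\psi(b)=(a,b)$. A subgroup $H\le G$ is dense in the profinite topology if $HN=G$ for every finite index normal subgroup $N$ of $G$. *)

theory Defs
  imports
    "HOL-Algebra.Coset"
    "HOL-Algebra.Generated_Groups"
    "HOL-Computational_Algebra.Polynomial"
    "HOL-Library.Z2"
begin

section \<open>The binary rooted tree and its automorphism group\<close>

text \<open>The letters 0 and 1 are represented by \<^const>\<open>False\<close> and \<^const>\<open>True\<close>.\<close>

type_synonym word = "bool list"

definition tree_adj :: "word \<Rightarrow> word \<Rightarrow> bool" where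
  "tree_adj u v \<longleftrightarrow> (\<exists>x. v = u @ [x]) \<or> (\<exists>x. u = v @ [x])"

definition tree_aut :: "(word \<Rightarrow> word) set" where
  "tree_aut = {g. bij g \<and> g [] = [] \<and> (\<forall>u v. tree_adj (g u) (g v) \<longleftrightarrow> tree_adj u v)}"

definition AutT :: "(word \<Rightarrow> word) monoid" where
  "AutT = \<lparr>carrier = tree_aut, monoid.mult = (\<circ>), one = id\<rparr>"

text \<open>
  The section \<open>g\<^sub>v\<close>. For a tree automorphism \<open>g\<close> the word \<open>g (v @ w)\<close> extends \<open>g v\<close>, which
  has the length of \<open>v\<close>; see \<open>section_at_unique\<close> below.
\<close>

definition section_at :: "(word \<Rightarrow> word) \<Rightarrow> word \<Rightarrow> (word \<Rightarrow> word)" where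
  "section_at g v = (\<lambda>w. drop (length v) (g (v @ w)))"

definition psi :: "(word \<Rightarrow> word) \<Rightarrow> (word \<Rightarrow> word) \<times> (word \<Rightarrow> word)" where
  "psi g = (section_at g [False], section_at g [True])"


section \<open>Sunic groups on the binary tree\<close>

text \<open>
  The group \<open>B\<close> is written additively: the product of the \<open>b\<^sub>i\<close> raised to the \<open>x i\<close>, for
  \<open>i < m\<close>, is the coordinate function \<open>x\<close>, extended by zero outside \<open>{..<m}\<close>. Here
  \<open>m = degree f\<close>. Likewise \<open>A\<close> is the additive group of the two-element field, with \<open>a\<close>
  corresponding to 1.
\<close>

definition B_vecs :: "bit poly \<Rightarrow> (nat \<Rightarrow> bit) set" where
  "B_vecs f = {x. \<forall>i\<ge>degree f. x i = 0}"

definition B_basis :: "nat \<Rightarrow> nat \<Rightarrow> bit" where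
  "B_basis i = (\<lambda>j. if j = i then 1 else 0)"

definition rho_basis :: "bit poly \<Rightarrow> nat \<Rightarrow> nat \<Rightarrow> bit" where
  "rho_basis f i =
     (if Suc i < degree f then B_basis (Suc i)
      else (\<lambda>j. if j < degree f then - coeff f j else 0))"

definition rho :: "bit poly \<Rightarrow> (nat \<Rightarrow> bit) \<Rightarrow> nat \<Rightarrow> bit" where
  "rho f x = (\<lambda>j. \<Sum>i<degree f. x i * rho_basis f i j)"

definition omega_basis :: "bit poly \<Rightarrow> nat \<Rightarrow> bit" where
  "omega_basis f i = (if Suc i < degree f then 0 else 1)"

definition omega :: "bit poly \<Rightarrow> (nat \<Rightarrow> bit) \<Rightarrow> bit" where
  "omega f x = (\<Sum>i<degree f. x i * omega_basis f i)"

fun act_a :: "word \<Rightarrow> word" where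
  "act_a [] = []"
| "act_a (x # w) = (\<not> x) # w"

definition act_A :: "bit \<Rightarrow> word \<Rightarrow> word" where
  "act_A s = (if s = 1 then act_a else id)"

fun act_B :: "bit poly \<Rightarrow> (nat \<Rightarrow> bit) \<Rightarrow> word \<Rightarrow> word" where
  "act_B f x [] = []"
| "act_B f x (False # w) = False # act_A (omega f x) w"
| "act_B f x (True # w) = True # act_B f (rho f x) w"

definition B_auts :: "bit poly \<Rightarrow> (word \<Rightarrow> word) set" where
  "B_auts f = act_B f ` B_vecs f"

definition Sunic_group :: "bit poly \<Rightarrow> (word \<Rightarrow> word) monoid" where
  "Sunic_group f = AutT\<lparr>carrier := generate AutT (insert act_a (B_auts f))\<rparr>"


section \<open>Torsion and the profinite topology\<close>

definition non_torsion :: "('a, 'b) monoid_scheme \<Rightarrow> bool" where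
  "non_torsion G \<longleftrightarrow> (\<exists>g\<in>carrier G. \<forall>n::nat. n > 0 \<longrightarrow> g [^]\<^bsub>G\<^esub> n \<noteq> \<one>\<^bsub>G\<^esub>)"

definition profinitely_dense :: "'a set \<Rightarrow> ('a, 'b) monoid_scheme \<Rightarrow> bool" where
  "profinitely_dense H G \<longleftrightarrow>
     (\<forall>N. normal N G \<and> finite (rcosets\<^bsub>G\<^esub> N) \<longrightarrow> H <#>\<^bsub>G\<^esub> N = carrier G)"


section \<open>Basic facts\<close>

lemma tree_aut_child:
  assumes g: "g \<in> tree_aut"
  shows "\<exists>y. g (w @ [x]) = g w @ [y]"
proof (induction w arbitrary: x rule: rev_induct)
  case Nil
  have "tree_adj [] [x]" by (simp add: tree_adj_def)
  then have "tree_adj (g []) (g [x])" using g unfolding tree_aut_def by blast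
  then show ?case using g by (auto simp: tree_aut_def tree_adj_def)
next
  case (snoc z w)
  from snoc obtain y where y: "g (w @ [z]) = g w @ [y]" by blast
  have "tree_adj (w @ [z]) ((w @ [z]) @ [x])" by (simp add: tree_adj_def)
  then have "tree_adj (g (w @ [z])) (g ((w @ [z]) @ [x]))"
    using g by (simp only: tree_aut_def mem_Collect_eq)
  moreover have "g ((w @ [z]) @ [x]) \<noteq> g w"
    using g by (auto simp: tree_aut_def bij_def dest: injD)
  ultimately show ?case using y unfolding tree_adj_def by auto
qed

lemma tree_aut_append:
  assumes g: "g \<in> tree_aut"
  shows "length (g v) = length v" "g (v @ w) = g v @ section_at g v w"
proof -
  show len: "length (g v) = length v" for v
  proof (induction v rule: rev_induct)
    case Nil
    then show ?case using g by (simp add: tree_aut_def)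
  next
    case (snoc x v)
    then show ?case using tree_aut_child[OF g, of v x] by auto
  qed
  have "\<exists>u. g (v @ w) = g v @ u"
  proof (induction w rule: rev_induct)
    case (snoc x w)
    then show ?case using tree_aut_child[OF g, of "v @ w" x] by auto
  qed simp
  then show "g (v @ w) = g v @ section_at g v w"
    using len[of v] by (auto simp: section_at_def)
qed

lemma section_at_in_tree_aut:
  assumes g: "g \<in> tree_aut"
  shows "section_at g v \<in> tree_aut"
proof -
  let ?h = "section_at g v"
  note app = tree_aut_append(2)[OF g, of v]
  note len = tree_aut_append(1)[OF g]
  have inj_g: "inj g" and surj_g: "surj g"
    using g by (auto simp: tree_aut_def bij_def)
  have "inj ?h"
  proof (rule injI)
    fix u w assume "?h u = ?h w"
    then have "g (v @ u) = g (v @ w)" by (simp add: app)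
    then show "u = w" using inj_g by (auto dest: injD)
  qed
  moreover have "surj ?h"
  proof (rule surjI[of _ "\<lambda>w. SOME y. ?h y = w"])
    fix w
    obtain u where u: "g u = g v @ w" using surj_g by (metis surjD)
    have "length u = length v + length w"
      using len[of u] len[of v] u by simp
    then have "g (take (length v) u) @ section_at g (take (length v) u) (drop (length v) u) = g v @ w"
      using tree_aut_append(2)[OF g, of "take (length v) u" "drop (length v) u"] u by simp
    moreover have "length (g (take (length v) u)) = length (g v)"
      using len \<open>length u = length v + length w\<close> by simp
    ultimately have "g (take (length v) u) = g v" by simp
    then have "take (length v) u = v" using inj_g by (auto dest: injD)
    then have "u = v @ drop (length v) u" by (metis append_take_drop_id)
    then have "g v @ ?h (drop (length v) u) = g v @ w" using app u by metis
    then have "?h (drop (length v) u) = w" by simp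
    then show "?h (SOME y. ?h y = w) = w" by (rule someI)
  qed
  moreover have "?h [] = []" using app[of "[]"] by simp
  moreover have "tree_adj (?h u) (?h w) \<longleftrightarrow> tree_adj u w" for u w
  proof -
    have "tree_adj (g v @ ?h u) (g v @ ?h w) \<longleftrightarrow> tree_adj (v @ u) (v @ w)"
      using g app by (simp add: tree_aut_def flip: app)
    then show ?thesis by (simp add: tree_adj_def)
  qed
  ultimately show ?thesis by (simp add: tree_aut_def bij_def)
qed

lemma section_at_unique:
  assumes "g \<in> tree_aut"
  shows "h \<in> tree_aut \<and> (\<forall>w. g (v @ w) = g v @ h w) \<longleftrightarrow> h = section_at g v"
  using tree_aut_append(2)[OF assms, of v] section_at_in_tree_aut[OF assms, of v]
  by (metis ext same_append_eq)

lemma group_AutT: "group AutT"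
proof (rule groupI)
  fix g assume g: "g \<in> carrier AutT"
  then have b: "bij g" and a: "\<And>u v. tree_adj (g u) (g v) \<longleftrightarrow> tree_adj u v" and e: "g [] = []"
    by (auto simp: AutT_def tree_aut_def)
  have "inv_into UNIV g \<in> tree_aut"
    using b e a unfolding tree_aut_def
    by (auto simp: bij_imp_bij_inv bij_is_inj bij_is_surj inv_f_eq)
       (metis bij_inv_eq_iff)+
  moreover have "inv_into UNIV g \<circ> g = id" using b by (simp add: bij_is_inj)
  ultimately show "\<exists>h\<in>carrier AutT. h \<otimes>\<^bsub>AutT\<^esub> g = \<one>\<^bsub>AutT\<^esub>"
    by (auto simp: AutT_def)
qed (auto simp: AutT_def tree_aut_def bij_comp o_assoc)

lemma act_a_act_a [simp]: "act_a (act_a w) = w"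
  by (cases w) auto

lemma tree_adj_Nil: "tree_adj [] w \<longleftrightarrow> (\<exists>x. w = [x])" "tree_adj w [] \<longleftrightarrow> (\<exists>x. w = [x])"
  by (auto simp: tree_adj_def)

lemma tree_adj_Cons: "tree_adj (x # u) (y # v) \<longleftrightarrow> x = y \<and> tree_adj u v"
  by (auto simp: tree_adj_def)

lemma act_a_in_tree_aut: "act_a \<in> tree_aut"
proof -
  have "bij act_a" by (rule o_bij[of act_a]) (auto simp: fun_eq_iff)
  moreover have "tree_adj (act_a u) (act_a v) \<longleftrightarrow> tree_adj u v" for u v
    by (cases u; cases v)
       (auto simp: tree_adj_Cons tree_adj_Nil)
  ultimately show ?thesis by (simp add: tree_aut_def)
qed

lemma act_A_in_tree_aut: "act_A s \<in> tree_aut"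
  using act_a_in_tree_aut by (simp add: act_A_def tree_aut_def)

lemma act_A_add: "act_A (s + t) = act_A s \<circ> act_A t"
  by (cases s; cases t) (auto simp: act_A_def fun_eq_iff)

lemma omega_add: "omega f (\<lambda>i. x i + y i) = omega f x + omega f y"
  by (simp only: omega_def distrib_right sum.distrib)

lemma rho_add: "rho f (\<lambda>i. x i + y i) = (\<lambda>i. rho f x i + rho f y i)"
  by (simp only: rho_def distrib_right sum.distrib)

lemma act_B_add: "act_B f (\<lambda>i. x i + y i) = act_B f x \<circ> act_B f y"
proof
  fix w show "act_B f (\<lambda>i. x i + y i) w = (act_B f x \<circ> act_B f y) w"
  proof (induction w arbitrary: x y)
    case (Cons c w)
    then show ?case by (cases c) (simp_all only: act_B.simps o_apply omega_add act_A_add rho_add)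
  qed simp
qed

lemma act_B_act_B [simp]: "act_B f x (act_B f x w) = w"
proof (induction w arbitrary: x)
  case (Cons c w)
  then show ?case by (cases c) (auto simp: act_A_def)
qed simp

lemma act_B_length: "length (act_B f x w) = length w"
proof (induction w arbitrary: x)
  case (Cons c w)
  then show ?case using tree_aut_append(1)[OF act_A_in_tree_aut] by (cases c) auto
qed simp

lemma act_B_in_tree_aut: "act_B f x \<in> tree_aut"
proof -
  have "bij (act_B f x)" by (rule o_bij[of "act_B f x"]) (auto simp: fun_eq_iff)
  moreover have "tree_adj (act_B f x u) (act_B f x v) \<longleftrightarrow> tree_adj u v" for u v
  proof (induction u arbitrary: x v)
    case Nil
    have "act_B f y w = [] \<longleftrightarrow> w = []" "act_A s w = [] \<longleftrightarrow> w = []" for y s w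
      using act_B_length[of f y w] tree_aut_append(1)[OF act_A_in_tree_aut, of s w] by auto
    then show ?case
      by (cases "(f, x, v)" rule: act_B.cases) (auto simp: tree_adj_Nil)
  next
    case (Cons d u)
    have "act_B f y w = [] \<longleftrightarrow> w = []" "act_A s w = [] \<longleftrightarrow> w = []" for y s w
      using act_B_length[of f y w] tree_aut_append(1)[OF act_A_in_tree_aut, of s w] by auto
    moreover have "tree_adj (act_A s u) (act_A s w) \<longleftrightarrow> tree_adj u w" for s w
      using act_A_in_tree_aut[of s] by (simp add: tree_aut_def)
    ultimately show ?case using Cons
      by (cases d; cases "(f, x, v)" rule: act_B.cases) (auto simp: tree_adj_Nil tree_adj_Cons)
  qed
  ultimately show ?thesis by (simp add: tree_aut_def)
qed

lemma psi_act_B: "psi (act_B f x) = (act_A (omega f x), act_B f (rho f x))"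
  by (simp add: psi_def section_at_def fun_eq_iff)

lemma group_Sunic_group: "group (Sunic_group f)"
proof -
  interpret group AutT by (rule group_AutT)
  have "insert act_a (B_auts f) \<subseteq> carrier AutT"
    using act_a_in_tree_aut act_B_in_tree_aut by (auto simp: AutT_def B_auts_def)
  then show ?thesis unfolding Sunic_group_def
    by (intro subgroup.subgroup_is_group generate_is_subgroup group_AutT)
qed

end

theory Submission
  imports Defs
begin

text \<open>
  Put \<open>q = 2k + 1\<close>. The reflection \<open>a' = (ab)\<^sup>q b\<close> is the conjugate of \<open>a\<close> by \<open>(ab)\<^sup>k\<close>, and \<open>H(q)\<close> is
  generated by \<open>a'\<close> and \<open>B\<close>. The section at 1 of an element of \<open>H(q)\<close> fixing the first level lies
  in \<open>H(q)\<close> again and needs about half as many letters \<open>a'\<close>. The square of \<open>(ab)\<^sup>j\<close> has section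
  \<open>(ab)\<^sup>j\<close> there, so by induction every power \<open>(ab)\<^sup>j\<close> in \<open>H(q)\<close> has \<open>j\<close> divisible by \<open>q\<close>, and \<open>ab\<close> is missing.

  For density it suffices that \<open>ab\<close> has order a power of two modulo every normal subgroup \<open>N\<close> of
  finite index, because \<open>q\<close> is odd. The group is regular branch over the normal closure \<open>K\<close> of the
  commutators \<open>[a, y]\<close> with \<open>y\<close> in the image under \<open>rho\<close> of the kernel of \<open>omega\<close>, and
  \<open>(ab)\<^sup>1\<^sup>6\<close> lies in \<open>K'\<close>: the element \<open>b\<close> inverts \<open>(ab)\<^sup>4\<close>, which lies in \<open>K\<close>, and also
  centralizes \<open>K\<close> modulo the first section of \<open>K'\<close>. Since \<open>N\<close> contains an element moving a vertex of some
  level \<open>n\<close>, it contains the copies of \<open>K'\<close> at level \<open>n\<close>, hence \<open>(ab)\<^sup>e\<close> with \<open>e = 16 * 2 ^ n\<close>.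
\<close>

section \<open>Integer multiples in non-commutative additive groups\<close>

primrec nat_mult :: "nat \<Rightarrow> 'a::group_add \<Rightarrow> 'a" where
  "nat_mult 0 g = 0"
| "nat_mult (Suc n) g = nat_mult n g + g"

definition int_mult :: "int \<Rightarrow> 'a::group_add \<Rightarrow> 'a" where
  "int_mult j g = (if j < 0 then - nat_mult (nat (- j)) g else nat_mult (nat j) g)"

lemma nat_mult_Suc_left: "nat_mult (Suc n) g = g + nat_mult n g"
  by (induction n) (simp_all add: add.assoc)

lemma int_mult_of_nat: "int_mult (int n) g = nat_mult n g"
  by (simp add: int_mult_def)

lemma int_mult_0: "int_mult 0 g = 0"
  by (simp add: int_mult_def)

lemma int_mult_1: "int_mult 1 g = g"
  by (simp add: int_mult_def nat_eq_iff2 flip: One_nat_def) simp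

lemma int_mult_succ: "int_mult (j + 1) g = int_mult j g + g"
proof (cases "j < 0")
  case True
  then obtain n where n: "j = - 1 - int n"
    by (metis add.commute minus_diff_commute negD of_nat_Suc uminus_add_conv_diff diff_minus_eq_add minus_add_distrib)
  have "int_mult (j + 1) g = - nat_mult n g"
    using n by (simp add: int_mult_def)
  moreover have "nat (- j) = Suc n" using n by simp
  then have "int_mult j g = - nat_mult (Suc n) g"
    using True by (simp only: int_mult_def if_True)
  ultimately show ?thesis
    by (simp only: nat_mult_Suc_left minus_add) (simp add: add.assoc)
next
  case False
  then show ?thesis by (simp add: int_mult_def nat_add_distrib)
qed

lemma int_mult_pred: "int_mult (j - 1) g = int_mult j g - g"
  using int_mult_succ[of "j - 1" g] by simp

lemma int_mult_add: "int_mult (i + j) g = int_mult i g + int_mult j g"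
proof (induction j rule: int_induct[where k = 0])
  case base
  show ?case by (simp add: int_mult_0)
next
  case (step1 j)
  then show ?case using int_mult_succ[of "i + j" g] int_mult_succ[of j g]
    by (simp add: add.assoc)
next
  case (step2 j)
  then show ?case by (metis add_diff_eq int_mult_pred)
qed

lemma int_mult_minus: "int_mult (- j) g = - int_mult j g"
  using int_mult_add[of "- j" j g] by (simp add: int_mult_0 eq_neg_iff_add_eq_0)

lemmas group_norm = add.assoc minus_add diff_conv_add_uminus

section \<open>Self-similar groups of Sunic type\<close>

text \<open>
  \<open>pr g h\<close> plays the role of the automorphism fixing the first level whose sections are
  \<open>g\<close> and \<open>h\<close>. On \<open>B\<close> the first section is \<open>om\<close> and the second one is \<open>rh\<close>. The
  last assumption holds exactly because the degree is at least two: the kernel of \<open>om\<close> is not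
  invariant under \<open>rh\<close>.
\<close>

locale sunic =
  fixes pr :: "'g::group_add \<Rightarrow> 'g \<Rightarrow> 'g" and a b :: 'g and B :: "'g set" and om rh :: "'g \<Rightarrow> 'g"
  assumes pr_add: "pr g h + pr g' h' = pr (g + g') (h + h')"
    and pr_inject: "pr g h = pr g' h' \<longleftrightarrow> g = g' \<and> h = h'"
    and pr_a_neq: "pr g h + a \<noteq> pr g' h'"
    and a_pr: "a + pr g h = pr h g + a"
    and a_a: "a + a = 0"
    and B_add: "x \<in> B \<Longrightarrow> y \<in> B \<Longrightarrow> x + y \<in> B"
    and B_self: "x \<in> B \<Longrightarrow> x + x = 0"
    and B_pr: "x \<in> B \<Longrightarrow> x = pr (om x) (rh x)"
    and om: "x \<in> B \<Longrightarrow> om x = 0 \<or> om x = a"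
    and rh_B: "x \<in> B \<Longrightarrow> rh x \<in> B"
    and rh_surj: "y \<in> B \<Longrightarrow> \<exists>x\<in>B. rh x = y"
    and rh_inj: "inj_on rh B"
    and b_B: "b \<in> B"
    and b_pr: "b = pr a b"
    and ex_z: "\<exists>y\<in>B. om y = 0 \<and> om (rh y) = a"
begin

lemma pr_0: "pr 0 0 = 0"
proof -
  have "pr 0 0 + pr 0 0 = pr 0 0" by (simp add: pr_add)
  then show ?thesis by (metis add_left_cancel add.right_neutral)
qed

lemma pr_minus: "- pr g h = pr (- g) (- h)"
  by (rule minus_unique) (simp add: pr_add pr_0)

lemma a_neq_pr: "a \<noteq> pr g h"
  using pr_a_neq[of 0 0 g h] by (simp add: pr_0)

lemma a_neq_0: "a \<noteq> 0"
  using a_neq_pr[of 0 0] by (simp add: pr_0)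

lemma minus_a: "- a = a"
  using a_a by (rule minus_unique)

lemma a_a_left: "a + (a + g) = g"
  using minus_add_cancel[of a g] by (simp add: minus_a)

lemma conj_a_pr: "a + pr g h + a = pr h g"
  by (simp add: a_pr add.assoc a_a)

lemma zero_B: "0 \<in> B"
  using B_add[OF b_B b_B] by (simp add: B_self b_B)

lemma minus_B: "x \<in> B \<Longrightarrow> - x = x"
  using B_self by (rule minus_unique)

lemma B_cancel: "x \<in> B \<Longrightarrow> x + (x + g) = g"
  using minus_add_cancel[of x g] by (simp add: minus_B)

lemma B_comm: "x \<in> B \<Longrightarrow> y \<in> B \<Longrightarrow> x + y = y + x"
  using minus_B[OF B_add[of x y]] by (simp add: minus_add minus_B)

lemma B_pr_add: assumes "x \<in> B" "y \<in> B"
  shows "om (x + y) = om x + om y" "rh (x + y) = rh x + rh y"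
  using B_pr[of "x + y"] B_pr[of x] B_pr[of y] assms B_add[of x y] pr_add pr_inject by metis+

lemma rh_eq_iff: "x \<in> B \<Longrightarrow> y \<in> B \<Longrightarrow> rh x = rh y \<longleftrightarrow> x = y"
  using rh_inj by (auto dest: inj_onD)

lemma om_b: "om b = a" and rh_b: "rh b = b"
  using B_pr[OF b_B] b_pr pr_inject by metis+

lemma b_b: "b + b = 0"
  using B_self b_B .

subsection \<open>The dihedral subgroup generated by a and b\<close>

text \<open>The translations of the dihedral group generated by the involutions \<open>a\<close> and
  \<open>b\<close>; conjugation by \<open>a\<close> or by \<open>b\<close> inverts them.\<close>

definition rot :: "int \<Rightarrow> 'g" where
  "rot j = int_mult j (a + b)"

lemma rot_add: "rot (i + j) = rot i + rot j"
  and rot_minus: "rot (- j) = - rot j"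
  and rot_0: "rot 0 = 0"
  and rot_1: "rot 1 = a + b"
  by (simp_all add: rot_def int_mult_add int_mult_minus int_mult_0 int_mult_1)

lemma a_rot: "a + rot j = rot (- j) + a"
proof -
  have 1: "a + (rot j + a) = rot (- j)" for j
  proof (induction j rule: int_induct[where k = 0])
    case base
    then show ?case by (simp add: rot_0 a_a)
  next
    case (step1 j)
    have "a + (rot (j + 1) + a) = (a + (rot j + a)) + (b + a)"
      by (simp add: rot_add rot_1 add.assoc)
    also have "\<dots> = rot (- j) + rot (- 1)"
      by (simp add: step1 rot_minus rot_1 minus_add minus_a minus_B b_B)
    finally show ?case by (simp flip: rot_add)
  next
    case (step2 j)
    have "a + (rot (j - 1) + a) = (a + (rot j + a)) + (a + (rot (- 1) + a))"
      using rot_add[of j "-1"] by (simp add: add.assoc a_a_left)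
    also have "\<dots> = rot (- j) + rot 1"
      by (simp add: step2 rot_minus rot_1 minus_add minus_a minus_B b_B add.assoc a_a)
    finally show ?case by (simp flip: rot_add)
  qed
  from 1[of j] show ?thesis by (metis a_a add.assoc add.right_neutral)
qed

lemma b_rot: "b + rot j = rot (- j) + b"
proof -
  have "b = a + rot 1" by (simp add: rot_1 a_a_left)
  then have "b + rot j = a + rot (1 + j)" "rot (- j) + b = rot (- j) + (a + rot 1)"
    by (metis add.assoc rot_add)+
  then show ?thesis by (metis a_rot add.assoc rot_add minus_minus add.commute)
qed

text \<open>From \<open>b = pr a b\<close> and \<open>a + b + a = pr b a\<close>, the square of
  \<open>a + b\<close> has sections \<open>b + a\<close> and \<open>a + b\<close>. So passing to a
  section halves an even exponent up to sign, which drives all later descents.\<close>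

lemma rot_double: "rot (2 * j) = pr (rot (- j)) (rot j)"
proof -
  have 1: "rot 2 = pr (rot (- 1)) (rot 1)"
  proof -
    have "rot 2 = (a + b + a) + b" using rot_add[of 1 1] by (simp add: rot_1 add.assoc)
    also have "\<dots> = pr b a + pr a b" using b_pr conj_a_pr by metis
    finally show ?thesis by (simp add: pr_add rot_minus rot_1 minus_add minus_a minus_B b_B)
  qed
  have m1: "rot (- 2) = pr (rot 1) (rot (- 1))"
    using 1 by (simp add: rot_minus pr_minus)
  show ?thesis
  proof (induction j rule: int_induct[where k = 0])
    case base
    then show ?case by (simp add: rot_0 pr_0)
  next
    case (step1 j)
    have "rot (2 * (j + 1)) = rot (2 * j) + rot 2" by (simp add: algebra_simps flip: rot_add)
    then show ?case by (simp add: step1 1 pr_add flip: rot_add)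
  next
    case (step2 j)
    have "rot (2 * (j - 1)) = rot (2 * j) + rot (- 2)" by (simp flip: rot_add)
    then show ?case by (simp add: step2 m1 pr_add flip: rot_add)
  qed
qed

lemma rot_double_add_one: "rot (2 * j + 1) = pr (rot (- j) + b) (rot j + a) + a"
proof -
  have "rot (2 * j + 1) = rot (2 * j) + (a + b + a) + a"
    by (simp add: rot_add rot_1 add.assoc a_a)
  also have "a + b + a = pr b a" using b_pr conj_a_pr by metis
  finally show ?thesis by (simp add: rot_double pr_add)
qed

lemma rot_double_add_one_b: "rot (2 * j + 1) + b = pr (rot (- j)) (rot j) + a"
  using rot_double[of j] by (simp add: rot_add rot_1 add.assoc b_b)

text \<open>Descent on the absolute value: an odd rotation moves the first level, and an even one is
  trivial only if the rotation with half its exponent is.\<close>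

lemma rot_eq_0_iff: "rot j = 0 \<longleftrightarrow> j = 0"
proof
  show "rot j = 0 \<Longrightarrow> j = 0"
  proof (induction "nat \<bar>j\<bar>" arbitrary: j rule: less_induct)
    case less
    show ?case
    proof (rule ccontr)
      assume "j \<noteq> 0"
      show False
      proof (cases "even j")
        case True
        then obtain i where i: "j = 2 * i" by blast
        with less.prems have "rot i = 0" using rot_double[of i] pr_0 pr_inject by metis
        moreover have "\<bar>i\<bar> < \<bar>j\<bar>" using i \<open>j \<noteq> 0\<close> by (simp add: abs_mult)
        ultimately show False using less.hyps[of i] i \<open>j \<noteq> 0\<close> by simp
      next
        case False
        then obtain i where "j = 2 * i + 1" by (blast elim: oddE)
        with less.prems show False
          using rot_double_add_one[of i] pr_0 pr_a_neq by metis
      qed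
    qed
  qed
qed (simp add: rot_0)

subsection \<open>The group and its self-similarity\<close>

text \<open>Prefixing single letters suffices: \<open>a\<close> and the elements of \<open>B\<close>
  are involutions, so the inverse of a word is again a word.\<close>

inductive_set G :: "'g set" where
  G_zero: "0 \<in> G"
| G_a: "g \<in> G \<Longrightarrow> a + g \<in> G"
| G_B: "x \<in> B \<Longrightarrow> g \<in> G \<Longrightarrow> x + g \<in> G"

lemma a_in_G: "a \<in> G" and B_in_G: "x \<in> B \<Longrightarrow> x \<in> G"
  using G_a[OF G_zero] G_B[OF _ G_zero] by simp_all

lemma G_add: "g \<in> G \<Longrightarrow> h \<in> G \<Longrightarrow> g + h \<in> G"
  by (induction rule: G.induct) (simp_all add: add.assoc G.intros)

lemma G_minus: "g \<in> G \<Longrightarrow> - g \<in> G"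
  by (induction rule: G.induct)
    (simp_all add: minus_add minus_a minus_B G_add a_in_G B_in_G G_zero)

lemma rot_in_G: "rot j \<in> G"
proof -
  have "nat_mult n (a + b) \<in> G" for n
    by (induction n) (simp_all add: G_zero G_add a_in_G B_in_G b_B)
  then show ?thesis by (simp add: rot_def int_mult_def G_minus)
qed

text \<open>\<open>a\<close> is the first section of \<open>b\<close>, and \<open>x \<in> B\<close>
  is the first section of \<open>a + y + a\<close> when \<open>rh y = x\<close>. Hence conjugation
  by any element of \<open>G\<close> can be realised below the first letter.\<close>

lemma G_self_replicating: "g \<in> G \<Longrightarrow> \<exists>h. pr g h \<in> G"
proof (induction rule: G.induct)
  case G_zero
  then show ?case using G.G_zero pr_0 by metis
next
  case (G_a g)
  then obtain h where "pr g h \<in> G" by blast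
  then have "pr a b + pr g h \<in> G" using G_B[OF b_B] b_pr by metis
  then show ?case by (auto simp: pr_add)
next
  case (G_B x g)
  then obtain h where h: "pr g h \<in> G" by blast
  obtain y where y: "y \<in> B" "rh y = x" using rh_surj G_B by blast
  have "pr x (om y) = a + y + a" using B_pr[OF y(1)] conj_a_pr y(2) by metis
  then have "pr x (om y) \<in> G" using y by (simp add: G_add a_in_G B_in_G)
  with h have "pr x (om y) + pr g h \<in> G" by (rule G_add[rotated])
  then show ?case by (auto simp: pr_add)
qed

text \<open>A subgroup normalized by \<open>G\<close> but possibly not contained in it, so that the
  set of all \<open>g\<close> with \<open>pr g 0 \<in> N\<close> qualifies without a proof that its
  elements lie in \<open>G\<close>.\<close>

definition normalized :: "'g set \<Rightarrow> bool" where
  "normalized N \<longleftrightarrow> 0 \<in> N \<and> (\<forall>g\<in>N. \<forall>h\<in>N. g + h \<in> N) \<and> (\<forall>g\<in>N. - g \<in> N)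
     \<and> (\<forall>g\<in>G. \<forall>h\<in>N. g + h - g \<in> N)"

lemma normalizedD:
  assumes "normalized N"
  shows "0 \<in> N" "g \<in> N \<Longrightarrow> h \<in> N \<Longrightarrow> g + h \<in> N" "g \<in> N \<Longrightarrow> - g \<in> N"
    "g \<in> N \<Longrightarrow> h \<in> N \<Longrightarrow> g - h \<in> N" "k \<in> G \<Longrightarrow> h \<in> N \<Longrightarrow> k + h - k \<in> N"
  using assms by (auto simp: normalized_def) (metis diff_conv_add_uminus)

lemma normalized_conj_a: "normalized N \<Longrightarrow> h \<in> N \<Longrightarrow> a + h + a \<in> N"
  using normalizedD(5)[OF _ a_in_G] by (metis diff_conv_add_uminus minus_a)

lemma normalized_conj_B: "normalized N \<Longrightarrow> x \<in> B \<Longrightarrow> h \<in> N \<Longrightarrow> x + h + x \<in> N"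
  using normalizedD(5)[OF _ B_in_G] by (metis diff_conv_add_uminus minus_B)

lemma normalized_pr_swap: "normalized N \<Longrightarrow> pr g h \<in> N \<Longrightarrow> pr h g \<in> N"
  using normalized_conj_a conj_a_pr by metis

lemma normalized_section:
  assumes "normalized N"
  shows "normalized {g. pr g 0 \<in> N}"
  unfolding normalized_def
proof (intro conjI ballI; clarify)
  show "pr 0 0 \<in> N" by (simp add: pr_0 normalizedD(1)[OF assms])
next
  fix g h assume "pr g 0 \<in> N" "pr h 0 \<in> N"
  then have "pr g 0 + pr h 0 \<in> N" by (rule normalizedD(2)[OF assms])
  then show "pr (g + h) 0 \<in> N" by (simp add: pr_add)
next
  fix g assume "pr g 0 \<in> N"
  then have "- pr g 0 \<in> N" by (rule normalizedD(3)[OF assms])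
  then show "pr (- g) 0 \<in> N" by (simp add: pr_minus)
next
  fix g h assume "g \<in> G" and h: "pr h 0 \<in> N"
  then obtain g' where "pr g g' \<in> G" using G_self_replicating by blast
  from normalizedD(5)[OF assms this h] show "pr (g + h - g) 0 \<in> N"
    by (simp add: pr_add pr_minus diff_conv_add_uminus del: add_uminus_conv_diff)
qed

subsection \<open>A regular branching subgroup\<close>

text \<open>Since \<open>a\<close> and \<open>rh y\<close> are involutions, each generator is the
  commutator of the two.\<close>

inductive_set K :: "'g set" where
  K_gen: "y \<in> B \<Longrightarrow> om y = 0 \<Longrightarrow> a + rh y + a + rh y \<in> K"
| K_add: "k \<in> K \<Longrightarrow> l \<in> K \<Longrightarrow> k + l \<in> K"
| K_minus: "k \<in> K \<Longrightarrow> - k \<in> K"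
| K_conj: "g \<in> G \<Longrightarrow> k \<in> K \<Longrightarrow> g + k - g \<in> K"

lemma normalized_K: "normalized K"
proof -
  obtain y where "y \<in> B" "om y = 0" using ex_z by blast
  then have "- (a + rh y + a + rh y) + (a + rh y + a + rh y) \<in> K"
    by (intro K_add K_minus K_gen)
  then have "0 \<in> K" by simp
  then show ?thesis unfolding normalized_def using K.intros by blast
qed

lemma K_induct_normalized:
  assumes "k \<in> K" "normalized N" "\<And>y. y \<in> B \<Longrightarrow> om y = 0 \<Longrightarrow> a + rh y + a + rh y \<in> N"
  shows "k \<in> N"
  using assms(1) by induction (simp_all add: assms(3) normalizedD[OF assms(2)])

lemma K_subset_G: "k \<in> K \<Longrightarrow> k \<in> G"
proof (erule K_induct_normalized)
  show "normalized G"
    by (auto simp: normalized_def G_zero G_add G_minus diff_conv_add_uminus simp del: add_uminus_conv_diff)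
qed (simp add: G_add a_in_G B_in_G rh_B)

text \<open>By \<open>normalized_section\<close> only generators matter. If \<open>om y = 0\<close>,
  then \<open>a + y + a = pr (rh y) 0\<close>, and its commutator with an element \<open>z\<close>
  of first section \<open>a\<close> is the generator for \<open>y\<close> placed in the first
  section. It lies in \<open>K\<close> because modulo \<open>K\<close> the element \<open>z\<close>
  equals \<open>a + z + a\<close>, which commutes with \<open>a + y + a\<close>.\<close>

lemma K_branching:
  assumes "k \<in> K"
  shows "pr k 0 \<in> K"
proof -
  have "pr (a + rh y + a + rh y) 0 \<in> K" if y: "y \<in> B" "om y = 0" for y
  proof -
    obtain w where w: "w \<in> B" "om w = 0" "om (rh w) = a" using ex_z by blast
    define z where "z = rh w"
    have z: "z \<in> B" "om z = a" using w rh_B by (auto simp: z_def)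
    define k where "k = a + z + a + z"
    have k: "k \<in> K" using w by (simp add: k_def z_def K_gen)
    define t where "t = a + y + a"
    have t: "t = pr (rh y) 0" using conj_a_pr B_pr[OF y(1)] y(2) t_def by metis
    have "pr (a + rh y + a + rh y) 0 = z + t + z + t"
      using B_pr[OF z(1)] z(2) B_self[OF rh_B[OF z(1)]]
      by (metis t pr_add add.right_neutral)
    \<comment> \<open>Besides \<open>a + z + a + k = z\<close> this only uses that
      \<open>a + z + a\<close> commutes with \<open>t\<close>, both being conjugates by
      \<open>a\<close> of elements of \<open>B\<close>.\<close>
    also have "\<dots> = (a + z + a) + (k + (t - k - t)) + (a + z + a)"
    proof -
      have tt: "- t = t" "t + (t + g) = g" for g
        using y(1) by (simp_all add: t_def minus_add minus_a minus_B add.assoc a_a_left B_cancel)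
      have yz: "y + (z + g) = z + (y + g)" for g
        using B_comm[OF y(1) z(1)] by (simp flip: add.assoc)
      show ?thesis
        using y(1) z(1)
        by (simp add: tt k_def group_norm minus_a minus_B a_a_left B_cancel del: add_uminus_conv_diff)
           (simp add: t_def add.assoc a_a_left B_cancel yz B_self a_a)
    qed
    also have "\<dots> \<in> K"
    proof -
      have "t \<in> G" unfolding t_def using y by (simp add: G_add a_in_G B_in_G)
      then have "t + (- k) - t \<in> K" using k by (intro K_conj K_minus)
      then have "k + (t - k - t) \<in> K" using k by (simp add: K_add)
      moreover have "a + z + a \<in> G" using z by (simp add: G_add a_in_G B_in_G)
      moreover have "- (a + z + a) = a + z + a" using z by (simp add: minus_add minus_a minus_B add.assoc)
      ultimately show ?thesis using K_conj diff_conv_add_uminus by metis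
    qed
    finally show ?thesis .
  qed
  then have "k \<in> {k. pr k 0 \<in> K}"
    by (intro K_induct_normalized[OF assms normalized_section[OF normalized_K]]) simp
  then show ?thesis by simp
qed


text \<open>\<open>rot 4\<close> has sections \<open>rot (- 2)\<close> and \<open>rot 2\<close>,
  while the commutator \<open>u\<close> of \<open>a\<close> and \<open>z\<close> has sections
  \<open>z1 + a\<close> and \<open>a + z1\<close>. As \<open>b\<close> is \<open>z1\<close> times an
  element \<open>y\<close> commuting with \<open>a\<close> modulo \<open>K\<close>, the sections of
  \<open>rot 4\<close> and \<open>u + u\<close> differ by elements of \<open>K\<close>, and
  branching applies.\<close>

lemma rot_4_in_K: "rot 4 \<in> K"
proof -
  obtain w where w: "w \<in> B" "om w = 0" "om (rh w) = a" using ex_z by blast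
  define z where "z = rh w"
  have z: "z \<in> B" "om z = a" using w rh_B by (auto simp: z_def)
  define z1 where "z1 = rh z"
  have z1: "z1 \<in> B" using z rh_B by (simp add: z1_def)
  define u where "u = a + z + a + z"
  have u: "u \<in> K" using w by (simp add: u_def z_def K_gen)
  have u_pr: "u = pr (z1 + a) (a + z1)"
    using B_pr[OF z(1)] z(2) conj_a_pr pr_add unfolding u_def z1_def by metis
  \<comment> \<open>Both summands have first section \<open>a\<close>, so \<open>x\<close> is in the
    kernel of \<open>om\<close>, and \<open>rh x\<close> is the element \<open>y\<close> defined
    next.\<close>
  define x where "x = b + z"
  have x: "x \<in> B" "om x = 0" "rh x = b + z1"
    using z b_B by (simp_all add: x_def B_add B_pr_add om_b rh_b z1_def a_a)
  define y where "y = b + z1"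
  have y: "y \<in> B" using z1 b_B by (simp add: y_def B_add)
  define k where "k = a + y + a + y"
  have k: "k \<in> K" using K_gen[OF x(1,2)] x(3) by (simp add: k_def y_def)
  have b: "b = z1 + y" using B_comm[OF b_B z1] z1 by (simp add: y_def B_cancel)
  \<comment> \<open>The error made when \<open>b = z1 + y\<close> is replaced by \<open>z1\<close>
    in \<open>b + a + b + a\<close>.\<close>
  define l where "l = - (z1 + a) + k + (z1 + a)"
  have "l \<in> K" using K_conj[of "- (z1 + a)" k] k z1
    by (simp add: l_def G_minus G_add a_in_G B_in_G)
  have yz1: "y + (z1 + g) = z1 + (y + g)" for g
    using B_comm[OF y z1] by (simp flip: add.assoc)
  have rot_m2: "rot (- 2) = (z1 + a) + (z1 + a) + l"
  proof -
    have "rot (- 2) = b + a + b + a"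
      using rot_add[of "-1" "-1"] by (simp add: rot_minus rot_1 minus_add minus_a minus_B b_B add.assoc)
    then show ?thesis using y z1
      by (simp add: b l_def k_def group_norm minus_a minus_B a_a_left B_cancel B_self yz1 del: add_uminus_conv_diff)
  qed
  have rot_2: "rot 2 = (a + z1) + (a + z1) + (a + l + a)"
  proof -
    have "rot 2 = a + rot (- 2) + a" using a_rot[of "-2"] by (simp add: add.assoc a_a)
    then show ?thesis by (simp only: rot_m2 add.assoc)
  qed
  have "rot 4 = pr (rot (- 2)) (rot 2)" using rot_double[of 2] by simp
  also have "\<dots> = u + u + pr l 0 + pr 0 (a + l + a)"
    by (simp add: rot_m2 rot_2 u_pr pr_add)
  also have "\<dots> \<in> K"
  proof (intro K_add u)
    show "pr l 0 \<in> K" using \<open>l \<in> K\<close> by (rule K_branching)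
    have "a + l + a \<in> K" using normalized_conj_a[OF normalized_K \<open>l \<in> K\<close>] .
    then show "pr 0 (a + l + a) \<in> K" using normalized_pr_swap[OF normalized_K] K_branching by blast
  qed
  finally show ?thesis .
qed

section \<open>The commutator subgroup of \<open>K\<close>\<close>

inductive_set K' :: "'g set" where
  K'_comm: "k \<in> K \<Longrightarrow> l \<in> K \<Longrightarrow> k + l - k - l \<in> K'"
| K'_add: "k \<in> K' \<Longrightarrow> l \<in> K' \<Longrightarrow> k + l \<in> K'"
| K'_minus: "k \<in> K' \<Longrightarrow> - k \<in> K'"

lemma normalized_K': "normalized K'"
  unfolding normalized_def
proof (intro conjI ballI)
  show "0 \<in> K'" using K'_comm[of 0 0] normalizedD(1)[OF normalized_K] by simp
next
  fix g k assume g: "g \<in> G" and "k \<in> K'"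
  from this(2) show "g + k - g \<in> K'"
  proof induction
    case (K'_comm k l)
    then have "(g + k - g) + (g + l - g) - (g + k - g) - (g + l - g) \<in> K'"
      using g by (intro K'.K'_comm K_conj)
    then show ?case by (simp add: group_norm del: add_uminus_conv_diff)
  next
    case (K'_add k l)
    then have "(g + k - g) + (g + l - g) \<in> K'" by (intro K'.K'_add)
    then show ?case by (simp add: group_norm del: add_uminus_conv_diff)
  next
    case (K'_minus k)
    then have "- (g + k - g) \<in> K'" by (intro K'.K'_minus)
    then show ?case by (simp add: group_norm del: add_uminus_conv_diff)
  qed
qed (auto intro: K'_add K'_minus)

subsection \<open>Centralizing K modulo a subgroup of the first section of K'\<close>

definition L :: "'g set" where
  "L = {l. pr l 0 \<in> K'}"

text \<open>Commutation with a single \<open>k\<close> modulo \<open>L\<close>: the argument for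
  \<open>b\<close> factors \<open>b\<close> differently for different generators of
  \<open>K\<close>.\<close>

definition centr :: "'g \<Rightarrow> 'g set" where
  "centr k = {g \<in> G. g + k - g - k \<in> L}"

definition C :: "'g set" where
  "C = {g \<in> G. \<forall>k\<in>K. g \<in> centr k}"

lemma normalized_L: "normalized L"
  unfolding L_def by (rule normalized_section[OF normalized_K'])

lemma centr_add: assumes "k \<in> K" "g \<in> centr k" "h \<in> centr k"
  shows "g + h \<in> centr k"
proof -
  have "g + (h + k - h - k) - g \<in> L"
    using assms normalizedD(5)[OF normalized_L] by (simp add: centr_def)
  then have "(g + (h + k - h - k) - g) + (g + k - g - k) \<in> L"
    using assms normalizedD(2)[OF normalized_L] by (simp add: centr_def)
  then show ?thesis using assms
    by (simp add: centr_def G_add group_norm del: add_uminus_conv_diff)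
qed

lemma centr_minus: assumes "g \<in> centr k"
  shows "- g \<in> centr k"
proof -
  have "- g + (- (g + k - g - k)) - (- g) \<in> L"
    using assms normalizedD(3,5)[OF normalized_L] G_minus unfolding centr_def by blast
  then show ?thesis using assms
    by (simp add: centr_def G_minus group_norm del: add_uminus_conv_diff)
qed

lemma centr_commute: "g \<in> G \<Longrightarrow> g + k = k + g \<Longrightarrow> g \<in> centr k"
  by (simp add: centr_def normalizedD(1)[OF normalized_L])

lemma C_add: "g \<in> C \<Longrightarrow> h \<in> C \<Longrightarrow> g + h \<in> C"
  by (simp add: C_def G_add centr_add)

lemma C_minus: "g \<in> C \<Longrightarrow> - g \<in> C"
  by (simp add: C_def G_minus centr_minus)

lemma normalized_C: "normalized C"
  unfolding normalized_def
proof (intro conjI ballI)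
  show "0 \<in> C" by (simp add: C_def G_zero centr_commute)
next
  fix g c assume g: "g \<in> G" and c: "c \<in> C"
  have "g + c - g \<in> centr k" if k: "k \<in> K" for k
  proof -
    have "- g + k - (- g) \<in> K" using g k by (intro K_conj G_minus)
    then have "c + (- g + k - (- g)) - c - (- g + k - (- g)) \<in> L"
      using c unfolding C_def centr_def by blast
    then have "g + (c + (- g + k - (- g)) - c - (- g + k - (- g))) - g \<in> L"
      using g normalizedD(5)[OF normalized_L] by blast
    moreover have "g + c - g \<in> G"
      using g c by (simp add: C_def G_add G_minus diff_conv_add_uminus del: add_uminus_conv_diff)
    ultimately show ?thesis
      by (simp add: centr_def group_norm del: add_uminus_conv_diff)
  qed
  moreover have "g + c - g \<in> G"
    using g c by (simp add: C_def G_add G_minus diff_conv_add_uminus del: add_uminus_conv_diff)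
  ultimately show "g + c - g \<in> C" by (simp add: C_def)
qed (auto intro: C_add C_minus)

text \<open>By branching \<open>pr k 0\<close> is in \<open>K\<close>, and its commutator with
  \<open>pr g h\<close> has the commutator of \<open>g\<close> and \<open>k\<close> as first section
  and a trivial second one.\<close>

lemma section_K_in_C: assumes "pr g h \<in> K" "g \<in> G"
  shows "g \<in> C"
proof -
  have "g \<in> centr k" if "k \<in> K" for k
  proof -
    have "pr g h + pr k 0 - pr g h - pr k 0 \<in> K'"
      using assms K_branching[OF that] by (intro K'_comm)
    then show ?thesis using assms
      by (simp add: centr_def L_def pr_minus pr_add diff_conv_add_uminus del: add_uminus_conv_diff)
  qed
  then show ?thesis using assms by (simp add: C_def)
qed

lemma rh_add_om_in_C: assumes "y \<in> B" "om y = 0"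
  shows "rh (rh y) + om (rh y) \<in> C"
proof (rule section_K_in_C)
  have y: "rh y \<in> B" using assms rh_B by blast
  have "a + rh y + a + rh y = pr (rh (rh y) + om (rh y)) (om (rh y) + rh (rh y))"
    using B_pr[OF y] conj_a_pr pr_add by metis
  then show "pr (rh (rh y) + om (rh y)) (om (rh y) + rh (rh y)) \<in> K"
    using K_gen[OF assms] by simp
  show "rh (rh y) + om (rh y) \<in> G"
    using om[OF y] B_in_G[OF rh_B[OF y]] a_in_G by (metis G_add G_zero)
qed

text \<open>
  Modulo \<open>L\<close>, the first section of \<open>[a, z]\<close> makes \<open>a\<close> act on \<open>K\<close> like \<open>rh z\<close>, so that \<open>b\<close> acts
  like \<open>a + y\<close> for some \<open>y\<close>, and the latter commutes with \<open>[a, y]\<close>.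
\<close>

lemma b_in_C: "b \<in> C"
proof -
  obtain w where w: "w \<in> B" "om w = 0" "om (rh w) = a" using ex_z by blast
  define z where "z = rh w"
  have z: "z \<in> B" "om z = a" using w rh_B by (auto simp: z_def)
  define z1 where "z1 = rh z"
  have z1: "z1 \<in> B" using z rh_B by (simp add: z1_def)
  have z1a: "z1 + a \<in> C" using rh_add_om_in_C[OF w(1,2)] w(3) by (simp add: z1_def z_def)
  then have az1: "a + z1 \<in> C" using C_minus[of "z1 + a"] z1 by (simp add: minus_add minus_a minus_B)
  \<comment> \<open>So \<open>b\<close> is central modulo \<open>C\<close>: there \<open>a\<close>
    agrees with \<open>z1\<close>, which commutes with \<open>b\<close>, and \<open>B\<close> is
    abelian.\<close>
  have comm: "b + g + b - g \<in> C" if "g \<in> G" for g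
    using that
  proof induction
    case G_zero
    then show ?case using normalizedD(1)[OF normalized_C] by (simp add: b_b)
  next
    case (G_a g)
    have "(b + (a + z1) + b) + (z1 + a) \<in> C"
      using normalized_conj_B[OF normalized_C b_B az1] z1a by (rule C_add)
    moreover have "(b + (a + z1) + b) + (z1 + a) = b + a + b + a"
      using B_comm[OF z1 b_B] z1 by (simp add: add.assoc) (metis add.assoc B_self add.right_neutral add.left_neutral)
    ultimately have "b + a + b + a \<in> C" by simp
    moreover have "a + (b + g + b - g) + a \<in> C" using normalized_conj_a[OF normalized_C G_a.IH] .
    ultimately have "(b + a + b + a) + (a + (b + g + b - g) + a) \<in> C" by (rule C_add)
    then show ?case
      by (simp add: group_norm minus_a minus_B b_B a_a_left B_cancel del: add_uminus_conv_diff)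
  next
    case (G_B x g)
    have "x + (b + g + b - g) + x \<in> C" using normalized_conj_B[OF normalized_C G_B(1) G_B.IH] .
    moreover have "x + (b + g) = b + (x + g)" for g
      using B_comm[OF b_B G_B(1)] by (simp flip: add.assoc)
    ultimately show ?case using G_B
      by (simp add: group_norm minus_B del: add_uminus_conv_diff)
  qed
  \<comment> \<open>By \<open>comm\<close> a conjugate of \<open>b\<close> differs from
    \<open>b\<close> by an element of \<open>C\<close>. This makes \<open>T\<close> normalized, so
    only generators of \<open>K\<close> have to be checked.\<close>
  define T where "T = {k \<in> K. b \<in> centr k}"
  have norm_T: "normalized T"
    unfolding normalized_def
  proof (intro conjI ballI)
    show "0 \<in> T" using normalizedD(1)[OF normalized_K] by (simp add: T_def centr_commute B_in_G b_B)
  next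
    fix k l assume k: "k \<in> T" and l: "l \<in> T"
    then have "k + (b + l - b - l) - k \<in> L"
      using K_subset_G normalizedD(5)[OF normalized_L] by (simp add: T_def centr_def)
    with k have "(b + k - b - k) + (k + (b + l - b - l) - k) \<in> L"
      using normalizedD(2)[OF normalized_L] by (simp add: T_def centr_def)
    then show "k + l \<in> T" using k l
      by (simp add: T_def K_add centr_def group_norm del: add_uminus_conv_diff)
  next
    fix k assume k: "k \<in> T"
    then have "- k + (- (b + k - b - k)) - (- k) \<in> L"
      using K_subset_G normalizedD(3,5)[OF normalized_L] G_minus unfolding T_def centr_def by blast
    then show "- k \<in> T" using k
      by (simp add: T_def K_minus centr_def group_norm del: add_uminus_conv_diff)
  next
    fix g k assume g: "g \<in> G" and k: "k \<in> T"
    have "- g + (b + g + b - g) - (- g) \<in> C"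
      using normalizedD(5)[OF normalized_C] comm[OF g] G_minus[OF g] by blast
    then have "- g + (b + g + b - g) - (- g) \<in> centr k" using k by (simp add: C_def T_def)
    moreover have "b \<in> centr k" using k by (simp add: T_def)
    ultimately have "(- g + (b + g + b - g) - (- g)) + b \<in> centr k"
      using k by (intro centr_add) (simp_all add: T_def)
    then have "- g + b + g \<in> centr k"
      by (simp add: group_norm b_b del: add_uminus_conv_diff)
    then have "g + ((- g + b + g) + k - (- g + b + g) - k) - g \<in> L"
      using g normalizedD(5)[OF normalized_L] by (simp add: centr_def)
    then have "b \<in> centr (g + k - g)"
      by (simp add: centr_def B_in_G b_B group_norm del: add_uminus_conv_diff)
    then show "g + k - g \<in> T" using g k by (simp add: T_def K_conj)
  qed
  \<comment> \<open>\<open>B1\<close> has index two in \<open>B\<close>. The element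
    \<open>x0\<close> below lies in the kernel of \<open>om\<close> but outside \<open>B1\<close>,
    and serves to move elements across the two cosets.\<close>
  define B1 where "B1 = {rh x | x. x \<in> B \<and> om x = 0}"
  have B1_add: "x + y \<in> B1" if "x \<in> B1" "y \<in> B1" for x y
  proof -
    obtain x' y' where "x' \<in> B" "om x' = 0" "x = rh x'" "y' \<in> B" "om y' = 0" "y = rh y'"
      using \<open>x \<in> B1\<close> \<open>y \<in> B1\<close> unfolding B1_def by blast
    then have "x' + y' \<in> B" "om (x' + y') = 0" "rh (x' + y') = x + y"
      by (simp_all add: B_add B_pr_add)
    then show ?thesis unfolding B1_def by (metis (mono_tags, lifting) mem_Collect_eq)
  qed
  have B1_index: "x + y \<in> B1" if xy: "x \<in> B" "y \<in> B" "x \<notin> B1" "y \<notin> B1" for x y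
  proof -
    obtain x' y' where *: "x' \<in> B" "rh x' = x" "y' \<in> B" "rh y' = y"
      using rh_surj xy(1,2) by metis
    then have "om x' = a" "om y' = a" using om xy(3,4) unfolding B1_def by blast+
    then have "om (x' + y') = 0" "rh (x' + y') = x + y"
      using * by (simp_all add: B_pr_add a_a)
    then show ?thesis using B_add[OF *(1,3)] unfolding B1_def
      by (metis (mono_tags, lifting) mem_Collect_eq)
  qed
  define x0 where "x0 = b + z"
  have x0: "x0 \<in> B" "om x0 = 0"
    using b_B z by (simp_all add: x0_def B_pr_add om_b a_a B_add)
  define y0 where "y0 = rh x0"
  have "y0 = z1 + b"
    using B_comm[OF b_B z1] b_B z by (simp add: y0_def x0_def B_pr_add rh_b z1_def)
  then have y0: "y0 \<in> B" "b = z1 + y0"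
    using b_B z1 by (simp_all add: B_add B_cancel)
  have "x0 \<notin> B1"
  proof
    assume "x0 \<in> B1"
    moreover have "z \<in> B1" using w unfolding B1_def z_def by blast
    ultimately have "x0 + z \<in> B1" by (rule B1_add)
    then have "b \<in> B1" using z by (simp add: x0_def add.assoc B_self)
    then obtain x where "x \<in> B" "om x = 0" "rh x = rh b" using rh_b unfolding B1_def by fastforce
    then show False using rh_eq_iff b_B om_b a_neq_0 by metis
  qed
  \<comment> \<open>Here \<open>b = (z1 + a) + (a + y) + (y + y0)\<close>. The outer summands lie in
    \<open>C\<close>, and \<open>a + y\<close> commutes with its own square
    \<open>k\<close>.\<close>
  have gen1: "a + rh x + a + rh x \<in> T" if x: "x \<in> B" "om x = 0" "x \<notin> B1" for x
  proof -
    define y where "y = rh x"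
    have y: "y \<in> B" using x rh_B by (simp add: y_def)
    define k where "k = a + y + a + y"
    have k: "k \<in> K" using K_gen[OF x(1,2)] by (simp add: k_def y_def)
    have "x + x0 \<in> B1" using B1_index x x0 \<open>x0 \<notin> B1\<close> by blast
    then obtain v where v: "v \<in> B" "om v = 0" "x + x0 = rh v" unfolding B1_def by blast
    have "om (rh v) = 0" "rh (rh v) = y + y0"
      unfolding v(3)[symmetric] using x x0 by (simp_all add: B_pr_add y_def y0_def)
    with rh_add_om_in_C[OF v(1,2)] have "y + y0 \<in> C" by simp
    with z1a k have "z1 + a \<in> centr k" "y + y0 \<in> centr k" by (simp_all add: C_def)
    moreover have "a + y \<in> centr k"
      using y by (intro centr_commute G_add a_in_G B_in_G) (simp_all add: k_def add.assoc)
    ultimately have "(z1 + a) + (a + y) + (y + y0) \<in> centr k" using centr_add[OF k] by blast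
    moreover have "(z1 + a) + (a + y) + (y + y0) = b"
      using y by (simp add: y0(2) add.assoc a_a_left B_cancel)
    ultimately show ?thesis using k by (simp add: T_def k_def y_def)
  qed
  \<comment> \<open>For \<open>x \<in> B1\<close> the commutator of \<open>a\<close> and
    \<open>y\<close> is that of \<open>a\<close> and \<open>y + y0\<close>, times the conjugate by
    \<open>y\<close> of the inverse of that of \<open>a\<close> and \<open>y0\<close>; both come
    from \<open>gen1\<close>.\<close>
  have gen: "a + rh x + a + rh x \<in> T" if x: "x \<in> B" "om x = 0" for x
  proof (cases "x \<in> B1")
    case False
    with gen1 x show ?thesis by blast
  next
    case True
    define y where "y = rh x"
    have y: "y \<in> B" using x rh_B by (simp add: y_def)
    have "x + x0 \<notin> B1"
    proof
      assume "x + x0 \<in> B1"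
      with True have "x + (x + x0) \<in> B1" by (rule B1_add)
      then show False using x \<open>x0 \<notin> B1\<close> by (simp add: B_cancel)
    qed
    then have "a + (y + y0) + a + (y + y0) \<in> T"
      using gen1[of "x + x0"] x x0 by (simp add: B_pr_add B_add y_def y0_def)
    moreover have "y + - (a + y0 + a + y0) + y \<in> T"
      using gen1[OF x0 \<open>x0 \<notin> B1\<close>]
      by (intro normalized_conj_B[OF norm_T y] normalizedD(3)[OF norm_T]) (simp add: y0_def)
    ultimately have "(a + (y + y0) + a + (y + y0)) + (y + - (a + y0 + a + y0) + y) \<in> T"
      by (rule normalizedD(2)[OF norm_T])
    moreover have "y0 + (y + g) = y + (y0 + g)" for g
      using B_comm[OF y y0(1)] by (simp flip: add.assoc)
    ultimately show ?thesis using y y0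
      by (simp add: y_def[symmetric] group_norm minus_a minus_B a_a_left B_cancel del: add_uminus_conv_diff)
  qed
  have "b \<in> centr k" if "k \<in> K" for k
    using K_induct_normalized[OF that norm_T gen] by (simp add: T_def)
  then show ?thesis by (simp add: C_def B_in_G b_B)
qed

text \<open>As \<open>b\<close> inverts rotations, its commutator with \<open>rot 4\<close> is
  \<open>rot (- 8)\<close>, which therefore lies in \<open>L\<close>. Filling both sections with
  \<open>rot (- 8)\<close> and \<open>rot 8\<close> gives \<open>rot 16\<close>.\<close>

lemma rot_16_in_K': "rot 16 \<in> K'"
proof -
  have "b + rot 4 - b - rot 4 \<in> L"
    using b_in_C rot_4_in_K by (simp add: C_def centr_def)
  moreover have "b + rot 4 - b - rot 4 = rot (- 8)"
  proof -
    have "b + rot 4 - b - rot 4 = rot (- 4) + b - b - rot 4" by (simp only: b_rot)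
    also have "\<dots> = rot (- 4) + rot (- 4)" using rot_minus[of 4] by simp
    finally show ?thesis by (simp flip: rot_add)
  qed
  ultimately have "rot (- 8) \<in> L" "rot 8 \<in> L"
    using normalizedD(3)[OF normalized_L, of "rot (-8)"] by (simp_all add: rot_minus)
  then have "pr (rot (- 8)) 0 \<in> K'" "pr 0 (rot 8) \<in> K'"
    using normalized_pr_swap[OF normalized_K'] by (auto simp: L_def)
  from K'_add[OF this] show ?thesis using rot_double[of 8] by (simp add: pr_add)
qed

subsection \<open>Normalized subgroups containing a rotation\<close>

text \<open>The copy of \<open>g\<close> acting below the leftmost vertex of level \<open>n\<close>,
  trivial outside that subtree.\<close>

primrec emb :: "nat \<Rightarrow> 'g \<Rightarrow> 'g" where
  "emb 0 g = g"
| "emb (Suc n) g = pr (emb n g) 0"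

lemma emb_add: "emb n (g + h) = emb n g + emb n h"
  by (induction n) (simp_all add: pr_add)

lemma emb_minus: "emb n (- g) = - emb n g"
  by (induction n) (simp_all add: pr_minus)

lemma emb_in_G: "k \<in> K \<Longrightarrow> emb n k \<in> G"
proof -
  have "k \<in> K \<Longrightarrow> emb n k \<in> K" by (induction n) (simp_all add: K_branching)
  then show "k \<in> K \<Longrightarrow> emb n k \<in> G" using K_subset_G by blast
qed

text \<open>The rotation moves the leftmost vertex of level \<open>Suc n\<close>, so the conjugate
  is supported on a disjoint subtree. In the induction \<open>rot_double\<close> replaces
  \<open>s\<close> by \<open>- s\<close> in the first section.\<close>

lemma conj_emb_commute:
  assumes "odd s"
  shows "(rot (2 ^ n * s) + emb (Suc n) g - rot (2 ^ n * s)) + emb (Suc n) h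
    = emb (Suc n) h + (rot (2 ^ n * s) + emb (Suc n) g - rot (2 ^ n * s))"
  using assms
proof (induction n arbitrary: s)
  case 0
  then obtain i where "s = 2 * i + 1" by (blast elim: oddE)
  then obtain g1 g2 where rot_s: "rot s = pr g1 g2 + a" using rot_double_add_one by blast
  have "rot s + pr g 0 - rot s = pr g1 g2 + (a + pr g 0 + a) + - pr g1 g2"
    by (simp add: rot_s group_norm minus_a del: add_uminus_conv_diff)
  also have "\<dots> = pr 0 (g2 + g - g2)" by (simp add: conj_a_pr pr_minus pr_add)
  finally show ?case by (simp add: pr_add)
next
  case (Suc n)
  have "rot (2 ^ Suc n * s) = pr (rot (2 ^ n * - s)) (rot (2 ^ n * s))"
    using rot_double[of "2 ^ n * s"] by (simp add: mult.assoc)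
  then show ?case using Suc.IH[of "- s"] Suc.prems
    by (simp add: pr_minus pr_add diff_conv_add_uminus del: add_uminus_conv_diff mult_minus_right)
qed

text \<open>The commutator trick: \<open>N\<close> contains \<open>t - x\<close>, where
  \<open>t\<close> is the conjugate of \<open>x\<close> by the rotation. As \<open>t\<close>
  commutes with \<open>x\<close> and \<open>y\<close>, the commutator of \<open>t - x\<close> with
  \<open>y\<close> is that of \<open>- x\<close> with \<open>y\<close>.\<close>

lemma emb_K'_subset:
  assumes N: "normalized N" and s: "odd s" and r: "rot (2 ^ n * s) \<in> N" and k: "k \<in> K'"
  shows "emb (Suc n) k \<in> N"
  using k
proof induction
  case (K'_comm k l)
  define r where "r = rot (2 ^ n * s)"
  \<comment> \<open>The sign makes the resulting commutator the copy of
    \<open>k + l - k - l\<close>.\<close>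
  define x where "x = emb (Suc n) (- k)"
  define y where "y = emb (Suc n) l"
  have G: "x \<in> G" "y \<in> G" unfolding x_def y_def
    using K'_comm by (simp_all only: emb_in_G K_minus)
  have r: "r \<in> N" using assms(3) by (simp add: r_def)
  define t where "t = r + x - r"
  have tx: "t + (x + g) = x + (t + g)" and ty: "t + (y + g) = y + (t + g)" for g
    using conj_emb_commute[OF s, of n] by (simp_all add: t_def r_def x_def y_def flip: add.assoc)
  have "x + - r - x \<in> N" using normalizedD(5)[OF N G(1) normalizedD(3)[OF N r]] .
  with r have "r + (x + - r - x) \<in> N" by (rule normalizedD(2)[OF N])
  then have "t - x \<in> N"
    by (simp add: t_def group_norm del: add_uminus_conv_diff)
  then have "(t - x) + (y + - (t - x) - y) \<in> N"
    using normalizedD(2)[OF N] normalizedD(5)[OF N G(2) normalizedD(3)[OF N]] by blast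
  moreover have "(t - x) + (y + - (t - x) - y) = - x + y + x - y"
  proof -
    have "t + (- x + g) = - x + (t + g)" for g
      using tx[of "- x + g"] by (metis add_minus_cancel minus_add_cancel)
    then show ?thesis
      by (simp add: tx ty group_norm del: add_uminus_conv_diff)
  qed
  ultimately show ?case
    by (simp only: x_def y_def emb_minus minus_minus) (simp only: emb_add emb_minus diff_conv_add_uminus)
next
  case (K'_add k l)
  then show ?case using normalizedD(2)[OF N] by (simp only: emb_add)
next
  case (K'_minus k)
  then show ?case using normalizedD(3)[OF N] by (simp only: emb_minus)
qed

text \<open>Induction applied to the first section of \<open>N\<close>; conjugation by
  \<open>a\<close> fills the second section too, so each level doubles the exponent.\<close>

lemma rot_in_normalized:
  assumes "normalized N" and "\<And>k. k \<in> K' \<Longrightarrow> emb n k \<in> N"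
  shows "rot (2 ^ n * 16 * t) \<in> N"
  using assms
proof (induction n arbitrary: N t)
  case 0
  have "rot (16 * t) \<in> K'"
  proof (induction t rule: int_induct[where k = 0])
    case base
    then show ?case by (simp add: rot_0 normalizedD(1)[OF normalized_K'])
  next
    case (step1 t)
    then show ?case using K'_add[OF _ rot_16_in_K'] by (simp add: distrib_left rot_add)
  next
    case (step2 t)
    have "rot (16 * t) + - rot 16 \<in> K'" using step2(2) rot_16_in_K' by (intro K'_add K'_minus)
    moreover have "rot (16 * (t - 1)) = rot (16 * t) + - rot 16"
      using rot_add[of "16 * t" "- 16"] rot_minus[of 16] by simp
    ultimately show ?case by simp
  qed
  then show ?case using 0(2)[of "rot (16 * t)"] by simp
next
  case (Suc n)
  have "rot (2 ^ n * 16 * t) \<in> {g. pr g 0 \<in> N}" for t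
  proof (rule Suc.IH)
    show "normalized {g. pr g 0 \<in> N}" using normalized_section[OF Suc.prems(1)] .
    show "emb n k \<in> {g. pr g 0 \<in> N}" if "k \<in> K'" for k
      using Suc.prems(2)[OF that] by simp
  qed
  then have "pr (rot (- (2 ^ n * 16 * t))) 0 \<in> N" "pr 0 (rot (2 ^ n * 16 * t)) \<in> N"
    using normalized_pr_swap[OF Suc.prems(1)] by (metis mem_Collect_eq mult_minus_right, blast)
  from normalizedD(2)[OF Suc.prems(1) this] show ?case
    using rot_double[of "2 ^ n * 16 * t"] by (simp add: pr_add mult.assoc)
qed

theorem power_two_rot_in_normalized:
  assumes "normalized N" "rot r \<in> N" "r > 0"
  shows "\<exists>M. \<forall>t. rot (2 ^ M * t) \<in> N"
proof -
  obtain n s where ns: "r = 2 ^ n * s" "odd s"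
  proof (rule multiplicity_decompose'[of r 2])
    fix y assume "r = 2 ^ multiplicity 2 r * y" "\<not> 2 dvd y"
    then show thesis using that by blast
  qed (use assms(3) in simp_all)
  then have "emb (Suc n) k \<in> N" if "k \<in> K'" for k
    using emb_K'_subset[OF assms(1) ns(2) _ that] assms(2) by simp
  \<comment> \<open>Level \<open>Suc n\<close> contributes \<open>2 ^ (n + 1)\<close> and
    \<open>16\<close> is \<open>2 ^ 4\<close>.\<close>
  from rot_in_normalized[OF assms(1) this] have "rot (2 ^ (n + 5) * t) \<in> N" for t
    by (simp add: power_add algebra_simps)
  then show ?thesis by blast
qed

text \<open>Since \<open>q\<close> is odd, Bezout writes \<open>a + b\<close> as a multiple of
  \<open>rot q\<close> in \<open>P\<close> plus a rotation in \<open>N\<close>. Together with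
  \<open>B\<close> this accounts for all generators of \<open>G\<close>.\<close>

lemma product_normalized_eq_G:
  assumes N: "normalized N" "rot r \<in> N" "r > 0" and q: "odd q"
    and P: "\<And>g h. g \<in> P \<Longrightarrow> h \<in> P \<Longrightarrow> g + h \<in> P" "\<And>g. g \<in> P \<Longrightarrow> - g \<in> P"
      "B \<subseteq> P" "P \<subseteq> G" "rot q \<in> P"
    and g: "g \<in> G"
  shows "\<exists>h\<in>P. \<exists>n\<in>N. g = h + n"
proof -
  obtain M where M: "\<And>t. rot (2 ^ M * t) \<in> N" using power_two_rot_in_normalized[OF N] by blast
  have "coprime q (2 ^ M)" using q by simp
  then obtain u t where ut: "u * q + t * 2 ^ M = 1" using bezout_int[of q "2 ^ M"] by auto
  have P_rot: "rot (u * q) \<in> P"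
  proof (induction u rule: int_induct[where k = 0])
    case base
    then show ?case using P(3) zero_B by (auto simp: rot_0)
  next
    case (step1 u)
    then show ?case using P(1)[OF _ P(5)] by (simp add: distrib_right rot_add)
  next
    case (step2 u)
    have "rot ((u - 1) * q) = rot (u * q) + - rot q"
      using rot_add[of "u * q" "- q"] by (simp add: left_diff_distrib rot_minus)
    then show ?case using P(1)[OF step2(2) P(2)[OF P(5)]] by simp
  qed
  define v where "v = rot (2 ^ M * t)"
  have v: "v \<in> N" using M by (simp add: v_def)
  have "rot (u * q) + v = rot 1" using ut by (simp add: v_def mult.commute flip: rot_add)
  then have a: "a = rot (u * q) + v + b" by (simp add: rot_1 add.assoc b_b)
  show ?thesis
    using g
  proof induction
    case G_zero
    then show ?case using P(3) zero_B normalizedD(1)[OF N(1)] by force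
  next
    case (G_a g)
    then obtain h n where h: "h \<in> P" "n \<in> N" "g = h + n" by blast
    \<comment> \<open>The factor \<open>v \<in> N\<close> is moved to the right past
      \<open>w\<close>, at the cost of a conjugation.\<close>
    define w where "w = b + h"
    have w: "w \<in> P" using P(1,3) h(1) b_B by (auto simp: w_def)
    then have "- w + v - (- w) \<in> N"
      using P(4) by (intro normalizedD(5)[OF N(1)] G_minus v) auto
    then have "(- w + v - (- w)) + n \<in> N" using h(2) by (rule normalizedD(2)[OF N(1)])
    moreover have "rot (u * q) + w \<in> P" using P(1) P_rot w by blast
    moreover have "a + g = (rot (u * q) + w) + ((- w + v - (- w)) + n)"
      by (subst a) (simp add: h(3) w_def add.assoc)
    ultimately show ?case by blast
  next
    case (G_B x g)
    then obtain h n where h: "h \<in> P" "n \<in> N" "g = h + n" by blast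
    have "x + h \<in> P" using P(1,3) h(1) G_B(1) by blast
    moreover have "x + g = (x + h) + n" by (simp add: h(3) add.assoc)
    ultimately show ?case using h(2) by blast
  qed
qed

subsection \<open>The subgroups H(q)\<close>

text \<open>An involution that generates together with \<open>B\<close> the same subgroup as
  \<open>rot q\<close> does, because \<open>b \<in> B\<close>.\<close>

definition reflect :: "int \<Rightarrow> 'g" where
  "reflect q = rot q + b"

inductive_set H :: "int \<Rightarrow> 'g set" for q where
  H_zero: "0 \<in> H q"
| H_refl: "h \<in> H q \<Longrightarrow> h + reflect q \<in> H q"
| H_B: "h \<in> H q \<Longrightarrow> x \<in> B \<Longrightarrow> h + x \<in> H q"

text \<open>\<open>n\<close> counts the letters \<open>reflect q\<close> in some word for the
  element, not necessarily a shortest one.\<close>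

inductive H_len :: "int \<Rightarrow> nat \<Rightarrow> 'g \<Rightarrow> bool" for q where
  H_len_0: "x \<in> B \<Longrightarrow> H_len q 0 x"
| H_len_Suc: "H_len q n h \<Longrightarrow> x \<in> B \<Longrightarrow> H_len q (Suc n) (h + reflect q + x)"

lemma H_len_B: "H_len q n h \<Longrightarrow> x \<in> B \<Longrightarrow> H_len q n (h + x)"
proof (erule H_len.cases)
  fix m g y
  assume *: "x \<in> B" "n = Suc m" "h = g + reflect q + y" "H_len q m g" "y \<in> B"
  then have "H_len q (Suc m) (g + reflect q + (y + x))" by (intro H_len_Suc B_add)
  with * show ?thesis by (simp add: add.assoc)
qed (simp add: B_add H_len_0)

lemma H_len_refl: "H_len q n h \<Longrightarrow> H_len q (Suc n) (h + reflect q)"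
  using H_len_Suc[OF _ zero_B] by fastforce

lemma H_imp_H_len: "h \<in> H q \<Longrightarrow> \<exists>n. H_len q n h"
  by (induction rule: H.induct) (use H_len_0 zero_B H_len_B H_len_refl in blast)+

lemma reflect_reflect: "reflect q + reflect q = 0"
  by (simp add: reflect_def add.assoc b_rot rot_minus) (simp add: b_b rot_minus b_rot flip: add.assoc)

lemma H_add: "g \<in> H q \<Longrightarrow> h \<in> H q \<Longrightarrow> h + g \<in> H q"
  by (induction rule: H.induct) (auto simp flip: add.assoc intro: H.intros)

lemma H_minus: "h \<in> H q \<Longrightarrow> - h \<in> H q"
proof (induction rule: H.induct)
  case (H_refl h)
  have "reflect q \<in> H q" using H.H_refl[OF H.H_zero] by simp
  then have "reflect q + - h \<in> H q" using H_refl by (intro H_add)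
  then show ?case by (simp add: minus_add minus_unique[OF reflect_reflect])
next
  case (H_B h x)
  have "x \<in> H q" using H.H_B[OF H.H_zero] H_B by simp
  then have "x + - h \<in> H q" using H_B by (intro H_add)
  then show ?case using H_B by (simp add: minus_add minus_B)
qed (simp add: H.H_zero)

text \<open>With \<open>q = 2 * k + 1\<close> the second section is the conjugate of
  \<open>om x\<close> by \<open>rot k\<close>, and conjugating \<open>a\<close> in this way gives
  back \<open>reflect q\<close>.\<close>

lemma reflect_conj_B:
  assumes "odd q" "x \<in> B"
  obtains g c where "reflect q + x + reflect q = pr g c" "c = 0 \<or> c = reflect q"
proof -
  obtain k where q: "q = 2 * k + 1" using assms(1) by (blast elim: oddE)
  have r1: "reflect q = pr (rot (- k)) (rot k) + a"
    by (simp add: reflect_def q rot_double_add_one_b)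
  have r2: "reflect q = a + pr (rot k) (rot (- k))"
    unfolding r1 by (simp add: a_pr)
  define c where "c = rot k + om x + rot (- k)"
  have "reflect q + x + reflect q
      = (pr (rot (- k)) (rot k) + a) + pr (om x) (rh x) + (a + pr (rot k) (rot (- k)))"
    using B_pr[OF assms(2)] r1 r2 by metis
  also have "\<dots> = pr (rot (- k)) (rot k) + (a + pr (om x) (rh x) + a) + pr (rot k) (rot (- k))"
    by (simp only: add.assoc)
  also have "\<dots> = pr (rot (- k) + rh x + rot k) c"
    by (simp add: conj_a_pr pr_add c_def)
  finally have "reflect q + x + reflect q = pr (rot (- k) + rh x + rot k) c" .
  moreover have "c = 0 \<or> c = reflect q"
  proof (cases "om x = 0")
    case True
    then show ?thesis by (simp add: c_def rot_minus)
  next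
    case False
    then have "om x = a" using om[OF assms(2)] by simp
    then have "c = rot k + rot k + a" using a_rot[of "- k"] by (simp add: c_def add.assoc)
    also have "\<dots> = rot (2 * k) + a" by (simp flip: rot_add)
    also have "\<dots> = reflect q" by (simp add: reflect_def q rot_add rot_1 add.assoc b_b)
    finally show ?thesis by simp
  qed
  ultimately show ?thesis by (rule that)
qed

text \<open>Letters are read in pairs; by \<open>reflect_conj_B\<close> each pair contributes at
  most one letter to the second section.\<close>

lemma H_len_section:
  assumes q: "odd q" and "H_len q (2 * n) h"
  shows "\<exists>g g' n'. h = pr g' g \<and> n' \<le> n \<and> H_len q n' g"
  using assms(2)
proof (induction n arbitrary: h)
  case 0
  then have "h \<in> B" by (auto elim: H_len.cases)
  then show ?case using B_pr rh_B H_len_0 by blast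
next
  case (Suc n)
  from Suc.prems obtain h1 y where 1: "H_len q (Suc (2 * n)) h1" "y \<in> B" "h = h1 + reflect q + y"
    by (auto elim: H_len.cases)
  from 1(1) obtain h0 x where 0: "H_len q (2 * n) h0" "x \<in> B" "h1 = h0 + reflect q + x"
    by (auto elim: H_len.cases)
  from Suc.IH[OF 0(1)] obtain g g' n' where g: "h0 = pr g' g" "n' \<le> n" "H_len q n' g" by blast
  obtain t c where c: "reflect q + x + reflect q = pr t c" "c = 0 \<or> c = reflect q"
    using reflect_conj_B[OF q 0(2)] .
  have "h = h0 + (reflect q + x + reflect q) + y" by (simp add: 1 0 add.assoc)
  also have "\<dots> = pr (g' + t + om y) (g + c + rh y)"
    unfolding c g(1) by (subst B_pr[OF 1(2)]) (simp add: pr_add)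
  finally have h: "h = pr (g' + t + om y) (g + c + rh y)" .
  have "\<exists>n''. n'' \<le> Suc n \<and> H_len q n'' (g + c + rh y)"
    using c(2) g(2,3) H_len_B[OF g(3) rh_B[OF 1(2)]] H_len_Suc[OF g(3) rh_B[OF 1(2)]]
    by (metis Suc_le_mono add.right_neutral le_SucI)
  with h show ?case by blast
qed

section \<open>Dihedral elements in H(q)\<close>

definition dihedral :: "int \<Rightarrow> 'g \<Rightarrow> bool" where
  "dihedral j h \<longleftrightarrow> h = rot j \<or> h = rot j + b"

lemma dihedral_section:
  assumes "dihedral j (pr g' g)"
  obtains i where "j = 2 * i" "dihedral i g" "g' = rot (- i) \<or> g' = rot (- i) + a"
proof (cases "even j")
  case True
  then obtain i where i: "j = 2 * i" by blast
  have "rot j + b = pr (rot (- i) + a) (rot i + b)"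
    by (subst b_pr) (simp add: i rot_double pr_add)
  then show thesis using that[OF i] assms i rot_double[of i]
    by (auto simp: dihedral_def pr_inject)
next
  case False
  then obtain i where "j = 2 * i + 1" by (blast elim: oddE)
  then show thesis using assms rot_double_add_one[of i] rot_double_add_one_b[of i] pr_a_neq
    unfolding dihedral_def by metis
qed

lemma dihedral_add_reflect:
  assumes "dihedral j h"
  obtains j' where "dihedral j' (h + reflect q)" "q dvd j' \<longleftrightarrow> q dvd j"
proof (cases "h = rot j")
  case True
  show thesis
    by (rule that[of "j + q"]) (simp_all add: dihedral_def True reflect_def rot_add add.assoc)
next
  case False
  then have "h + reflect q = rot j + (b + rot q) + b"
    using assms by (simp add: dihedral_def reflect_def add.assoc)
  also have "\<dots> = rot (j - q)" using rot_add[of j "- q"] by (simp add: b_rot add.assoc b_b)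
  finally have "dihedral (j - q) (h + reflect q)" by (simp add: dihedral_def)
  moreover have "q dvd j - q \<longleftrightarrow> q dvd j"
    by (metis diff_add_cancel dvd_add_left_iff dvd_refl)
  ultimately show thesis by (rule that)
qed

text \<open>The first section of \<open>x\<close> is \<open>0\<close> or \<open>a\<close>, so some
  \<open>rot (- i)\<close> is \<open>0\<close> or \<open>a\<close>. It cannot be \<open>a\<close>,
  an involution, because nontrivial rotations have infinite order.\<close>

lemma dihedral_B:
  assumes "x \<in> B" "dihedral j x"
  shows "j = 0"
proof -
  have "dihedral j (pr (om x) (rh x))" using assms B_pr by metis
  then obtain i where i: "j = 2 * i" "om x = rot (- i) \<or> om x = rot (- i) + a"
    by (rule dihedral_section)
  then have "rot (- i) = 0 \<or> rot (- i) = a"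
    using om[OF assms(1)] by (metis a_a add.left_neutral add_right_cancel)
  moreover have "rot (- i) \<noteq> a"
  proof
    assume "rot (- i) = a"
    then have "rot (- i + - i) = 0" by (simp only: rot_add a_a)
    then have "i = 0" by (simp add: rot_eq_0_iff)
    with \<open>rot (- i) = a\<close> show False using a_neq_0 by (simp add: rot_0)
  qed
  ultimately show ?thesis using i by (simp add: rot_eq_0_iff)
qed

text \<open>Strong induction on the length. For even length the second section halves both the
  length bound and \<open>j\<close>; for odd length one more \<open>reflect q\<close> makes it even
  and changes \<open>j\<close> by \<open>q\<close>.\<close>

lemma H_len_dihedral:
  assumes q: "odd q"
  shows "H_len q n h \<Longrightarrow> dihedral j h \<Longrightarrow> q dvd j"
proof (induction n arbitrary: h j rule: less_induct)
  case (less n)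
  have ends: "q dvd j" if x: "x \<in> B" "dihedral j x \<or> dihedral j (x + reflect q)" for x j
  proof (cases "dihedral j x")
    case True
    then show ?thesis using dihedral_B[OF x(1) True] by simp
  next
    case False
    with x have "dihedral j (x + reflect q)" by simp
    then obtain j' where "dihedral j' (x + reflect q + reflect q)" "q dvd j' \<longleftrightarrow> q dvd j"
      by (rule dihedral_add_reflect)
    then show ?thesis using dihedral_B[OF x(1), of j'] by (simp add: add.assoc reflect_reflect)
  qed
  have even_len: "q dvd j" if h: "H_len q (2 * l) h" "dihedral j h" "l < n" for l h j
  proof -
    obtain g g' n' where g: "h = pr g' g" "n' \<le> l" "H_len q n' g"
      using H_len_section[OF q h(1)] by blast
    obtain i where "j = 2 * i" "dihedral i g"
      using h(2) unfolding g(1) by (rule dihedral_section)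
    moreover have "n' < n" using g(2) h(3) by simp
    ultimately show ?thesis using less.IH[OF _ g(3)] by simp
  qed
  \<comment> \<open>Length one needs its own case: completing it to two and halving returns to one.
    Its section is an element of \<open>B\<close>, possibly followed by \<open>reflect q\<close>, as
    covered by \<open>ends\<close>.\<close>
  consider "n = 0" | "n = 1" | l where "n = 2 * l" "l < n" | l where "n + 1 = 2 * l" "l < n"
  proof -
    have "n = 0 \<or> n = 1 \<or> n = 2 * (n div 2) \<and> n div 2 < n \<or> n + 1 = 2 * ((n + 1) div 2) \<and> (n + 1) div 2 < n"
      by presburger
    then show thesis using that by blast
  qed
  then show ?case
  proof cases
    case 1
    with less.prems(1) have "h \<in> B" by (auto elim: H_len.cases)
    then show ?thesis using ends less.prems(2) by blast
  next
    case 2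
    with less.prems(1) obtain h0 y where h0: "H_len q 0 h0" "y \<in> B" "h = h0 + reflect q + y"
      by (auto elim: H_len.cases)
    then have "h0 \<in> B" by (auto elim: H_len.cases)
    obtain t c where c: "reflect q + y + reflect q = pr t c" "c = 0 \<or> c = reflect q"
      using reflect_conj_B[OF q h0(2)] .
    have "h + reflect q = h0 + (reflect q + y + reflect q)" by (simp add: h0 add.assoc)
    also have "\<dots> = pr (om h0 + t) (rh h0 + c)"
      unfolding c by (subst B_pr[OF \<open>h0 \<in> B\<close>]) (simp add: pr_add)
    finally have h: "h + reflect q = pr (om h0 + t) (rh h0 + c)" .
    obtain j' where j': "dihedral j' (h + reflect q)" "q dvd j' \<longleftrightarrow> q dvd j"
      using dihedral_add_reflect[OF less.prems(2)] .
    then obtain i where "j' = 2 * i" "dihedral i (rh h0 + c)"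
      unfolding h using dihedral_section by blast
    moreover from this(2) c(2) have "q dvd i" using ends[OF rh_B[OF \<open>h0 \<in> B\<close>], of i] by auto
    ultimately show ?thesis using j' by simp
  next
    case 3
    then show ?thesis using even_len less.prems by blast
  next
    case 4
    obtain j' where "dihedral j' (h + reflect q)" "q dvd j' \<longleftrightarrow> q dvd j"
      using dihedral_add_reflect[OF less.prems(2)] .
    moreover have "H_len q (2 * l) (h + reflect q)"
      using H_len_refl[OF less.prems(1)] 4(1) by simp
    ultimately show ?thesis using even_len 4(2) by blast
  qed
qed

theorem rot_1_notin_H:
  assumes "odd q" "q \<ge> 3"
  shows "rot 1 \<notin> H q"
proof
  assume "rot 1 \<in> H q"
  then obtain n where "H_len q n (rot 1)" using H_imp_H_len by blast
  then have "q dvd 1" by (rule H_len_dihedral[OF assms(1)]) (simp add: dihedral_def)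
  with assms(2) show False by (simp add: zdvd_not_zless)
qed

end


section \<open>Tree automorphisms as an additive group\<close>

text \<open>A type of its own can be made an instance of \<open>group_add\<close>, as the locale
  \<open>sunic\<close> requires.\<close>

typedef taut = tree_aut
  using act_a_in_tree_aut by blast

setup_lifting type_definition_taut

lemma tree_aut_comp: "g \<in> tree_aut \<Longrightarrow> h \<in> tree_aut \<Longrightarrow> g \<circ> h \<in> tree_aut"
  using group.is_monoid[OF group_AutT] monoid.m_closed[of AutT g h] by (simp add: AutT_def)

lemma tree_aut_inv: "g \<in> tree_aut \<Longrightarrow> inv\<^bsub>AutT\<^esub> g \<in> tree_aut"
  using group.inv_closed[OF group_AutT, of g] by (simp add: AutT_def)

instantiation taut :: group_add
begin

lift_definition zero_taut :: taut is id
  by (simp add: tree_aut_def)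

lift_definition plus_taut :: "taut \<Rightarrow> taut \<Rightarrow> taut" is "(\<circ>)"
  by (rule tree_aut_comp)

lift_definition uminus_taut :: "taut \<Rightarrow> taut" is "\<lambda>g. inv\<^bsub>AutT\<^esub> g"
  by (rule tree_aut_inv)

definition minus_taut :: "taut \<Rightarrow> taut \<Rightarrow> taut" where
  "minus_taut g h = g + - h"

instance
proof
  show "g + h + k = g + (h + k)" for g h k :: taut by transfer auto
  show "0 + g = g" "g + 0 = g" for g :: taut by (transfer, simp)+
  show "- g + g = 0" for g :: taut
    by transfer (use group.l_inv[OF group_AutT] in \<open>simp add: AutT_def\<close>)
  show "g + - h = g - h" for g h :: taut by (simp add: minus_taut_def)
qed

end

fun pair_fun :: "(word \<Rightarrow> word) \<Rightarrow> (word \<Rightarrow> word) \<Rightarrow> word \<Rightarrow> word" where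
  "pair_fun g h [] = []"
| "pair_fun g h (False # w) = False # g w"
| "pair_fun g h (True # w) = True # h w"

lemma pair_fun_comp: "pair_fun g h \<circ> pair_fun g' h' = pair_fun (g \<circ> g') (h \<circ> h')"
proof
  show "(pair_fun g h \<circ> pair_fun g' h') w = pair_fun (g \<circ> g') (h \<circ> h') w" for w
    by (cases "(g, h, w)" rule: pair_fun.cases) simp_all
qed

lemma pair_fun_id: "pair_fun id id = id"
proof
  show "pair_fun id id w = id w" for w
    by (cases "(id :: word \<Rightarrow> word, id :: word \<Rightarrow> word, w)" rule: pair_fun.cases) simp_all
qed

lemma pair_fun_in_tree_aut:
  assumes g: "g \<in> tree_aut" and h: "h \<in> tree_aut"
  shows "pair_fun g h \<in> tree_aut"
proof -
  have "bij (pair_fun g h)"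
    using g h by (intro o_bij[of "pair_fun (inv_into UNIV g) (inv_into UNIV h)"])
      (simp_all add: pair_fun_comp tree_aut_def bij_def pair_fun_id surj_iff)
  moreover
  have single: "(\<exists>y. pair_fun g h w = [y]) \<longleftrightarrow> (\<exists>x. w = [x])" for w
  proof -
    have "g w = [] \<longleftrightarrow> w = []" "h w = [] \<longleftrightarrow> w = []" for w
      using tree_aut_append(1)[OF g, of w] tree_aut_append(1)[OF h, of w] by auto
    then show ?thesis by (cases "(g, h, w)" rule: pair_fun.cases) simp_all
  qed
  have "tree_adj (pair_fun g h u) (pair_fun g h v) \<longleftrightarrow> tree_adj u v" for u v
  proof (cases "u = [] \<or> v = []")
    case True
    then show ?thesis using single[of u] single[of v] by (auto simp: tree_adj_Nil)
  next
    case False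
    then obtain c u' d v' where "u = c # u'" "v = d # v'" by (metis neq_Nil_conv)
    then show ?thesis using g h by (cases c; cases d) (simp_all add: tree_adj_Cons tree_aut_def)
  qed
  ultimately show ?thesis by (simp add: tree_aut_def)
qed

lift_definition pair :: "taut \<Rightarrow> taut \<Rightarrow> taut" is pair_fun
  by (rule pair_fun_in_tree_aut)

lift_definition swap :: taut is act_a
  by (rule act_a_in_tree_aut)

lift_definition taut_B :: "bit poly \<Rightarrow> (nat \<Rightarrow> bit) \<Rightarrow> taut" is act_B
  by (rule act_B_in_tree_aut)

lift_definition taut_A :: "bit \<Rightarrow> taut" is act_A
  by (rule act_A_in_tree_aut)

lemma pair_add: "pair g h + pair g' h' = pair (g + g') (h + h')"
  by transfer (rule pair_fun_comp)

lemma pair_inject: "pair g h = pair g' h' \<longleftrightarrow> g = g' \<and> h = h'"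
proof transfer
  fix g h g' h' :: "word \<Rightarrow> word"
  have "g = g' \<and> h = h'" if "pair_fun g h = pair_fun g' h'"
  proof -
    have "False # g w = False # g' w" "True # h w = True # h' w" for w
      using fun_cong[OF that, of "False # w"] fun_cong[OF that, of "True # w"] by simp_all
    then show ?thesis by auto
  qed
  then show "pair_fun g h = pair_fun g' h' \<longleftrightarrow> g = g' \<and> h = h'" by blast
qed

lemma pair_swap_neq: "pair g h + swap \<noteq> pair g' h'"
proof transfer
  fix g h g' h' :: "word \<Rightarrow> word"
  have "(pair_fun g h \<circ> act_a) [False] \<noteq> pair_fun g' h' [False]" by simp
  then show "pair_fun g h \<circ> act_a \<noteq> pair_fun g' h'" by metis
qed

lemma swap_pair: "swap + pair g h = pair h g + swap"
proof transfer
  fix g h :: "word \<Rightarrow> word"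
  show "act_a \<circ> pair_fun g h = pair_fun h g \<circ> act_a"
  proof
    show "(act_a \<circ> pair_fun g h) w = (pair_fun h g \<circ> act_a) w" for w
      by (cases "(g, h, w)" rule: pair_fun.cases) simp_all
  qed
qed

lemma swap_swap: "swap + swap = 0"
  by transfer auto

lemma taut_B_add: "taut_B f x + taut_B f y = taut_B f (\<lambda>i. x i + y i)"
  by transfer (simp only: act_B_add)

lemma taut_B_self: "taut_B f x + taut_B f x = 0"
  by transfer (auto simp: fun_eq_iff)

lemma taut_B_pair: "taut_B f x = pair (taut_A (omega f x)) (taut_B f (rho f x))"
proof transfer
  fix f x
  show "act_B f x = pair_fun (act_A (omega f x)) (act_B f (rho f x))"
  proof
    show "act_B f x w = pair_fun (act_A (omega f x)) (act_B f (rho f x)) w" for w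
      by (cases "(f, x, w)" rule: act_B.cases) simp_all
  qed
qed

lemma taut_A_simps: "taut_A 0 = 0" "taut_A 1 = swap"
  by (transfer, simp add: act_A_def)+

text \<open>Meaningful only on the range of \<open>pair\<close>, that is, on elements fixing the first level.\<close>

definition sec0 :: "taut \<Rightarrow> taut" where "sec0 x = (THE g. \<exists>h. x = pair g h)"

definition sec1 :: "taut \<Rightarrow> taut" where "sec1 x = (THE h. \<exists>g. x = pair g h)"

lemma sec_pair [simp]: "sec0 (pair g h) = g" "sec1 (pair g h) = h"
  unfolding sec0_def sec1_def by (rule the_equality; auto simp: pair_inject)+

lemma sec_taut_B: "sec0 (taut_B f x) = taut_A (omega f x)" "sec1 (taut_B f x) = taut_B f (rho f x)"
  by (subst taut_B_pair, simp)+

lemma act_B_cong: "(\<And>i. i < degree f \<Longrightarrow> x i = y i) \<Longrightarrow> act_B f x = act_B f y"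
proof
  fix w assume "\<And>i. i < degree f \<Longrightarrow> x i = y i"
  then have "omega f x = omega f y" "rho f x = rho f y"
    by (simp_all add: omega_def rho_def)
  then show "act_B f x w = act_B f y w"
    by (cases "(f, x, w)" rule: act_B.cases) simp_all
qed

lemma range_act_B: "range (act_B f) = B_auts f"
proof
  show "range (act_B f) \<subseteq> B_auts f"
  proof clarify
    fix x
    have "act_B f x = act_B f (\<lambda>i. if i < degree f then x i else 0)"
      by (rule act_B_cong) simp
    then show "act_B f x \<in> B_auts f" by (auto simp: B_auts_def B_vecs_def)
  qed
qed (auto simp: B_auts_def)

lemma Rep_range_taut_B: "Rep_taut ` range (taut_B f) = B_auts f"
  by (simp add: image_image taut_B.rep_eq range_act_B)

lemma finite_range_taut_B: "finite (range (taut_B f))"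
proof -
  have "finite {x :: nat \<Rightarrow> bit. \<forall>i. (i \<in> {..<degree f} \<longrightarrow> x i \<in> UNIV) \<and> (i \<notin> {..<degree f} \<longrightarrow> x i = 0)}"
  proof (intro finite_set_of_finite_funs)
    have "(UNIV :: bit set) \<subseteq> {0, 1}" by (metis bit_not_zero_iff insertCI subsetI)
    then show "finite (UNIV :: bit set)" by (rule finite_subset) simp
  qed simp
  moreover have "B_vecs f \<subseteq> \<dots>" by (auto simp: B_vecs_def)
  ultimately have "finite (B_auts f)" unfolding B_auts_def by (blast intro: finite_subset finite_imageI)
  then show ?thesis
    unfolding Rep_range_taut_B[symmetric] by (rule finite_imageD) (simp add: Rep_taut_inject inj_on_def)
qed

section \<open>Linear algebra of \<open>rho\<close> and \<open>omega\<close>\<close>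

lemma rho_eq:
  assumes "degree f = Suc n" "j < Suc n"
  shows "rho f x j = (if j = 0 then 0 else x (j - 1)) + x n * coeff f j"
proof -
  have "rho f x j = (\<Sum>i<n. x i * rho_basis f i j) + x n * rho_basis f n j"
    by (simp add: rho_def assms)
  also have "(\<Sum>i<n. x i * rho_basis f i j) = (\<Sum>i<n. if i = j - 1 then (if j = 0 then 0 else x (j - 1)) else 0)"
    using assms by (intro sum.cong refl) (auto simp: rho_basis_def B_basis_def)
  also have "\<dots> = (if j = 0 then 0 else x (j - 1))"
    using assms by (cases "j - 1 < n") auto
  finally show ?thesis using assms by (simp add: rho_basis_def)
qed

lemma rho_surj:
  assumes "coeff f 0 \<noteq> 0" "degree f = Suc n"
  obtains x where "\<And>j. j < degree f \<Longrightarrow> rho f x j = y j"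
proof -
  \<comment> \<open>Coordinate 0 of the image is \<open>x n\<close>, as the constant coefficient is
    1; this fixes \<open>x n = y 0\<close>, and the shift determines the rest.\<close>
  define x where "x = (\<lambda>i. if i = n then y 0 else y (Suc i) + y 0 * coeff f (Suc i))"
  have "rho f x j = y j" if "j < degree f" for j
    using that assms by (cases j) (auto simp: rho_eq[OF assms(2)] x_def add.assoc)
  then show thesis by (rule that)
qed

lemma omega_eq: "degree f = Suc n \<Longrightarrow> omega f x = x n"
  by (simp add: omega_def omega_basis_def)

lemma ex_kernel_not_invariant:
  assumes f: "degree f = Suc n" "n \<ge> 1"
  shows "\<exists>x. omega f x = 0 \<and> omega f (rho f x) = 1"
proof -
  have "rho f (B_basis (n - 1)) n = 1"
    using f by (simp add: rho_eq[OF f(1)] B_basis_def)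
  moreover have "B_basis (n - 1) n = 0" using f by (simp add: B_basis_def)
  ultimately show ?thesis using omega_eq[OF f(1)] by metis
qed

lemma sunic_taut:
  assumes "degree f \<ge> 2" "coeff f 0 \<noteq> 0" "b \<in> range (taut_B f)" "b = pair swap b"
  shows "sunic pair swap b (range (taut_B f)) sec0 sec1"
proof
  obtain n where n: "degree f = Suc n" "n \<ge> 1" using assms(1) by (cases "degree f") auto
  show "pair g h + pair g' h' = pair (g + g') (h + h')" for g h g' h' by (rule pair_add)
  show "pair g h = pair g' h' \<longleftrightarrow> g = g' \<and> h = h'" for g h g' h' by (rule pair_inject)
  show "pair g h + swap \<noteq> pair g' h'" for g h g' h' by (rule pair_swap_neq)
  show "swap + pair g h = pair h g + swap" for g h by (rule swap_pair)
  show "swap + swap = 0" by (rule swap_swap)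
  show "x + y \<in> range (taut_B f)" if "x \<in> range (taut_B f)" "y \<in> range (taut_B f)" for x y
    using that by (auto simp: taut_B_add)
  show "x + x = 0" if "x \<in> range (taut_B f)" for x using that by (auto simp: taut_B_self)
  show "x = pair (sec0 x) (sec1 x)" if "x \<in> range (taut_B f)" for x
  proof -
    from that obtain v where "x = taut_B f v" by blast
    then show ?thesis by (simp only: sec_taut_B flip: taut_B_pair)
  qed
  show "sec0 x = 0 \<or> sec0 x = swap" if "x \<in> range (taut_B f)" for x
  proof -
    have "s = 0 \<or> s = 1" for s :: bit by (cases s) simp_all
    with that show ?thesis by (auto simp: sec_taut_B) (metis taut_A_simps)
  qed
  show "sec1 x \<in> range (taut_B f)" if "x \<in> range (taut_B f)" for x
    using that by (auto simp: sec_taut_B)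
  show surj: "\<exists>x\<in>range (taut_B f). sec1 x = y" if "y \<in> range (taut_B f)" for y
  proof -
    from that obtain v where v: "y = taut_B f v" by blast
    obtain x where "\<And>j. j < degree f \<Longrightarrow> rho f x j = v j"
      using rho_surj[OF assms(2) n(1), of v] by blast
    then have "taut_B f (rho f x) = y" unfolding v
      by (metis Rep_taut_inject taut_B.rep_eq act_B_cong)
    then show ?thesis by (metis rangeI sec_taut_B(2))
  qed
  \<comment> \<open>A surjection of a finite set onto itself is injective.\<close>
  have "range (taut_B f) \<subseteq> sec1 ` range (taut_B f)"
  proof
    fix y assume "y \<in> range (taut_B f)"
    from surj[OF this] obtain x where "x \<in> range (taut_B f)" "sec1 x = y" ..
    then show "y \<in> sec1 ` range (taut_B f)" by blast
  qed
  then show "inj_on sec1 (range (taut_B f))"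
    using finite_range_taut_B by (rule finite_surj_inj[rotated])
  show "b \<in> range (taut_B f)" "b = pair swap b" by fact+
  show "\<exists>y\<in>range (taut_B f). sec0 y = 0 \<and> sec0 (sec1 y) = swap"
  proof -
    obtain x where "omega f x = 0" "omega f (rho f x) = 1" using ex_kernel_not_invariant[OF n] by blast
    then show ?thesis by (intro bexI[of _ "taut_B f x"]) (simp_all add: sec_taut_B taut_A_simps)
  qed
qed


section \<open>Sunic groups as an instance\<close>

lemma Rep_taut_simps:
  "Rep_taut (g + h) = Rep_taut g \<circ> Rep_taut h" "Rep_taut 0 = id"
  by (simp_all add: plus_taut.rep_eq zero_taut.rep_eq)

lemma Sunic_group_simps:
  "g \<otimes>\<^bsub>Sunic_group f\<^esub> h = g \<circ> h" "\<one>\<^bsub>Sunic_group f\<^esub> = id"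
  by (simp_all add: Sunic_group_def AutT_def)

lemma Rep_nat_mult: "Rep_taut (nat_mult n g) = Rep_taut g [^]\<^bsub>Sunic_group f\<^esub> n"
  by (induction n) (simp_all add: Rep_taut_simps Sunic_group_simps)

lemma taut_B_eq_pair_swap:
  assumes "psi (Rep_taut b) = (act_a, Rep_taut b)" "b \<in> range (taut_B f)"
  shows "b = pair swap b"
proof -
  obtain x where x: "b = taut_B f x" using assms(2) by blast
  then have "Rep_taut (taut_A (omega f x)) = Rep_taut swap" "Rep_taut (taut_B f (rho f x)) = Rep_taut b"
    using assms(1) by (simp_all add: taut_B.rep_eq taut_A.rep_eq swap.rep_eq psi_act_B)
  then show ?thesis using taut_B_pair[of f x] by (simp only: Rep_taut_inject x)
qed

theorem theorem5p1:
  fixes f :: "bit poly" and m q :: nat and b :: "word \<Rightarrow> word"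
    and G :: "(word \<Rightarrow> word) monoid" and H :: "(word \<Rightarrow> word) set"
  assumes f_monic: "lead_coeff f = 1"
    and f_deg: "degree f = m"
    and m_ge: "m \<ge> 2"
    and f_const: "coeff f 0 \<noteq> 0"
    and G_def: "G = Sunic_group f"
    and G_non_torsion: "non_torsion G"
    and b_in: "b \<in> B_auts f"
    and b_psi: "psi b = (act_a, b)"
    and q_odd: "odd q"
    and q_ge: "q \<ge> 3"
    and H_def: "H = generate G (insert ((act_a \<otimes>\<^bsub>G\<^esub> b) [^]\<^bsub>G\<^esub> q) (B_auts f))"
  shows "subgroup H G \<and> H \<noteq> carrier G \<and> profinitely_dense H G"
proof -
  interpret G: group G unfolding G_def by (rule group_Sunic_group)
  have "b \<in> Rep_taut ` range (taut_B f)" using b_in by (simp only: Rep_range_taut_B)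
  then obtain \<beta> where \<beta>: "\<beta> \<in> range (taut_B f)" "b = Rep_taut \<beta>" by blast
  interpret S: sunic pair swap \<beta> "range (taut_B f)" sec0 sec1
    using m_ge f_const b_psi \<beta> unfolding f_deg[symmetric]
    by (intro sunic_taut taut_B_eq_pair_swap) simp_all
  note mult = Sunic_group_simps[of f, folded G_def]
  have B_Rep: "B_auts f = Rep_taut ` range (taut_B f)" by (simp only: Rep_range_taut_B)
  have carrier: "carrier G = Rep_taut ` S.G"
  proof
    have AutT_inv: "inv\<^bsub>AutT\<^esub> (Rep_taut g) = Rep_taut (- g)" for g
      by (simp add: uminus_taut.rep_eq)
    have AutT_mult: "g \<otimes>\<^bsub>AutT\<^esub> h = g \<circ> h" for g h by (simp add: AutT_def)
    show "carrier G \<subseteq> Rep_taut ` S.G"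
    proof
      fix g assume "g \<in> carrier G"
      then have "g \<in> generate AutT (insert act_a (B_auts f))"
        by (simp add: G_def Sunic_group_def)
      then show "g \<in> Rep_taut ` S.G"
      proof induction
        case one
        then show ?case using S.G_zero by (force simp: AutT_def Rep_taut_simps)
      next
        case (incl h)
        then show ?case using S.a_in_G S.B_in_G unfolding B_Rep by (force simp: swap.rep_eq)
      next
        case (inv h)
        then obtain k where "k \<in> S.G" "h = Rep_taut k"
          using S.a_in_G S.B_in_G swap.rep_eq unfolding B_Rep by (metis imageE insertE)
        then show ?case using S.G_minus AutT_inv by blast
      next
        case (eng g h)
        then obtain g' h' where "g' \<in> S.G" "g = Rep_taut g'" "h' \<in> S.G" "h = Rep_taut h'" by blast
        then show ?case using S.G_add[of g' h'] by (force simp: AutT_def Rep_taut_simps)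
      qed
    qed
    have "Rep_taut g \<in> generate AutT (insert act_a (B_auts f))" if "g \<in> S.G" for g
      using that
    proof induction
      case G_zero
      have "\<one>\<^bsub>AutT\<^esub> = Rep_taut 0" by (simp add: AutT_def Rep_taut_simps)
      then show ?case using generate.one[of AutT] by metis
    next
      case (G_a g)
      have "act_a \<in> generate AutT (insert act_a (B_auts f))" by (simp add: generate.incl)
      from generate.eng[OF this G_a.IH] show ?case
        by (simp only: AutT_mult Rep_taut_simps swap.rep_eq)
    next
      case (G_B x g)
      then have "Rep_taut x \<in> generate AutT (insert act_a (B_auts f))"
        unfolding B_Rep by (simp add: generate.incl)
      from generate.eng[OF this G_B.IH] show ?case
        by (simp only: AutT_mult Rep_taut_simps)
    qed
    then show "Rep_taut ` S.G \<subseteq> carrier G" by (auto simp: G_def Sunic_group_def)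
  qed
  have G_inv: "inv\<^bsub>G\<^esub> (Rep_taut g) = Rep_taut (- g)" if "g \<in> S.G" for g
  proof (rule G.inv_equality)
    show "Rep_taut (- g) \<otimes>\<^bsub>G\<^esub> Rep_taut g = \<one>\<^bsub>G\<^esub>"
      by (simp add: mult flip: Rep_taut_simps)
  qed (use that S.G_minus in \<open>auto simp: carrier\<close>)
  have ab: "act_a \<otimes>\<^bsub>G\<^esub> b = Rep_taut (swap + \<beta>)"
    by (simp add: mult Rep_taut_simps swap.rep_eq \<beta>)
  have ab_pow: "(act_a \<otimes>\<^bsub>G\<^esub> b) [^]\<^bsub>G\<^esub> n = Rep_taut (S.rot (int n))" for n :: nat
    unfolding ab S.rot_def int_mult_of_nat by (simp only: Rep_nat_mult[of _ _ f] G_def)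
  have gens: "insert ((act_a \<otimes>\<^bsub>G\<^esub> b) [^]\<^bsub>G\<^esub> q) (B_auts f) \<subseteq> carrier G"
    unfolding ab_pow B_Rep carrier using S.rot_in_G S.B_in_G by blast
  have H_sub: "subgroup H G" unfolding H_def by (rule G.generate_is_subgroup[OF gens])
  \<comment> \<open>An upper bound for \<open>H\<close> is all that properness requires.\<close>
  have H_subset: "H \<subseteq> Rep_taut ` S.H (int q)"
  proof
    fix h assume "h \<in> H"
    have gen: "\<exists>k. k \<in> S.H (int q) \<and> k \<in> S.G \<and> x = Rep_taut k"
      if "x \<in> insert ((act_a \<otimes>\<^bsub>G\<^esub> b) [^]\<^bsub>G\<^esub> q) (B_auts f)" for x
    proof -
      have "0 + S.reflect (int q) + \<beta> \<in> S.H (int q)" by (intro S.H.intros \<beta>)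
      then have "S.rot (int q) \<in> S.H (int q)" by (simp add: S.reflect_def add.assoc S.b_b)
      moreover have "x \<in> S.H (int q)" if "x \<in> range (taut_B f)" for x
        using S.H_B[OF S.H_zero that] by simp
      ultimately show ?thesis using that S.rot_in_G S.B_in_G unfolding ab_pow B_Rep
        by (metis imageE insertE)
    qed
    from \<open>h \<in> H\<close> show "h \<in> Rep_taut ` S.H (int q)" unfolding H_def
    proof induction
      case one
      then show ?case using S.H_zero by (force simp: mult Rep_taut_simps)
    next
      case (incl h)
      from gen[OF this] show ?case by auto
    next
      case (inv h)
      from gen[OF this] obtain k where "k \<in> S.H (int q)" "k \<in> S.G" "h = Rep_taut k" by auto
      then show ?case using G_inv[of k] S.H_minus[of k "int q"] by simp
    next
      case (eng g h)
      then obtain g' h' where "g' \<in> S.H (int q)" "g = Rep_taut g'" "h' \<in> S.H (int q)" "h = Rep_taut h'"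
        by blast
      then show ?case using S.H_add[of h' "int q" g'] by (force simp: mult Rep_taut_simps)
    qed
  qed
  have "H \<noteq> carrier G"
  proof
    assume "H = carrier G"
    then have "Rep_taut (S.rot 1) \<in> H" using S.rot_in_G by (simp add: carrier)
    then have "S.rot 1 \<in> S.H (int q)" using H_subset by (auto simp: Rep_taut_inject)
    then show False using S.rot_1_notin_H[of "int q"] q_odd q_ge by simp
  qed
  moreover have "profinitely_dense H G"
    unfolding profinitely_dense_def
  proof (intro allI impI; elim conjE)
    fix N assume "normal N G" and fin: "finite (rcosets\<^bsub>G\<^esub> N)"
    interpret N: normal N G by fact
    define N' where "N' = {g. Rep_taut g \<in> N}"
    have N'_G: "g \<in> S.G" if "g \<in> N'" for g
      using that N.subset unfolding N'_def carrier by (auto simp: Rep_taut_inject)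
    have "S.normalized N'"
      unfolding S.normalized_def
    proof (intro conjI ballI)
      show "0 \<in> N'" using N.one_closed by (simp add: N'_def mult Rep_taut_simps)
    next
      fix g h assume "g \<in> N'" "h \<in> N'"
      then show "g + h \<in> N'" using N.m_closed by (simp add: N'_def mult Rep_taut_simps)
    next
      fix g assume "g \<in> N'"
      then show "- g \<in> N'" using N.m_inv_closed G_inv[OF N'_G] by (metis N'_def mem_Collect_eq)
    next
      fix g h assume g: "g \<in> S.G" and h: "h \<in> N'"
      have "Rep_taut g \<otimes>\<^bsub>G\<^esub> Rep_taut h \<otimes>\<^bsub>G\<^esub> inv\<^bsub>G\<^esub> Rep_taut g \<in> N"
        using g h by (intro N.inv_op_closed2) (auto simp: carrier N'_def)
      then have "Rep_taut (g + h + - g) \<in> N" by (simp only: G_inv[OF g] mult Rep_taut_simps)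
      then show "g + h - g \<in> N'" by (simp add: N'_def)
    qed
    \<comment> \<open>Pigeonhole: two powers of \<open>ab\<close> share a coset of \<open>N\<close>,
      so their quotient lies in \<open>N\<close>.\<close>
    moreover obtain r where "r > 0" "S.rot r \<in> N'"
    proof -
      define c where "c = (\<lambda>i::nat. N #>\<^bsub>G\<^esub> Rep_taut (S.rot (int i)))"
      have rot_carrier: "Rep_taut (S.rot i) \<in> carrier G" for i
        using S.rot_in_G by (simp add: carrier)
      have "range c \<subseteq> rcosets\<^bsub>G\<^esub> N"
        using rot_carrier by (auto simp: c_def RCOSETS_def)
      then have "\<not> inj c" using fin finite_imageD finite_subset infinite_UNIV_nat by blast
      then obtain i j where ij: "c i = c j" "i < j"
        unfolding inj_def by (metis linorder_less_linear)
      have "Rep_taut (S.rot (int j)) \<in> c j"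
        unfolding c_def by (intro G.rcos_self rot_carrier N.subgroup_axioms)
      then have "Rep_taut (S.rot (int j)) \<in> c i" by (simp only: ij(1))
      then obtain n where n: "n \<in> N" "Rep_taut (S.rot (int j)) = n \<circ> Rep_taut (S.rot (int i))"
        by (auto simp: c_def r_coset_def mult)
      then obtain n' where n': "n = Rep_taut n'" using N.subset by (auto simp: carrier)
      with n(2) have "S.rot (int j) = n' + S.rot (int i)"
        by (metis Rep_taut_inject Rep_taut_simps(1))
      then have "n' = S.rot (int j - int i)"
        using S.rot_add[of "int j - int i" "int i"] by simp
      then show thesis using ij(2) n(1) n' that[of "int j - int i"] by (simp add: N'_def)
    qed
    moreover have "odd (int q)" using q_odd by simp
    \<comment> \<open>Density needs elements of \<open>H\<close> itself, so \<open>P\<close> is its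
      preimage and not \<open>S.H (int q)\<close>.\<close>
    moreover define P where "P = {g. Rep_taut g \<in> H}"
    have P_G: "P \<subseteq> S.G"
      using subgroup.subset[OF H_sub] unfolding P_def carrier by (auto simp: Rep_taut_inject)
    have "g + h \<in> P" if "g \<in> P" "h \<in> P" for g h
      using that subgroup.m_closed[OF H_sub] by (simp add: P_def mult Rep_taut_simps)
    moreover have "- g \<in> P" if "g \<in> P" for g
      using that subgroup.m_inv_closed[OF H_sub] G_inv P_G by (metis P_def mem_Collect_eq subsetD)
    moreover have "x \<in> P" if "x \<in> range (taut_B f)" for x
      using that unfolding P_def H_def B_Rep by (blast intro: generate.incl)
    then have "range (taut_B f) \<subseteq> P" by blast
    moreover have "S.rot (int q) \<in> P"
      unfolding P_def H_def ab_pow by (simp add: generate.incl)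
    ultimately have dec: "\<exists>h\<in>P. \<exists>n\<in>N'. g = h + n" if "g \<in> S.G" for g
      using S.product_normalized_eq_G[of N' _ "int q" P g] P_G that by blast
    show "H <#>\<^bsub>G\<^esub> N = carrier G"
    proof
      show "H <#>\<^bsub>G\<^esub> N \<subseteq> carrier G"
        using subgroup.subset[OF H_sub] N.subset by (rule G.set_mult_closed)
      show "carrier G \<subseteq> H <#>\<^bsub>G\<^esub> N"
      proof
        fix g assume "g \<in> carrier G"
        then obtain k where "k \<in> S.G" "g = Rep_taut k" by (auto simp: carrier)
        with dec obtain h n where "h \<in> P" "n \<in> N'" "g = Rep_taut (h + n)" by blast
        then show "g \<in> H <#>\<^bsub>G\<^esub> N"
          by (auto simp: set_mult_def mult P_def N'_def Rep_taut_simps)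
      qed
    qed
  qed
  ultimately show ?thesis using H_sub by blast
qed

end
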